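(* Let $0<p<\frac23$ be fixed. Then there exist a positive constant $\epsilon_p$ and a function $\eta_p:(0,\epsilon_p)\to\mathbb R$ with $\eta_p(\epsilon)\to 0$ as $\epsilon\to 0$ (both depending only on $p$) such that the following holds for all $0<\epsilon<\epsilon_p$ and all positive integers $n$. Let $\boldsymbol p=(p,p,\ldots,p)\in(0,1)^n$. If $\mathcal A\subset 2^{[n]}$ is a $3$-wise intersecting family with $\mu_{\boldsymbol p}(\mathcal A)=p-\epsilon$, then there exists a star $\mathcal B\subset 2^{[n]}$ such that (i) if $p\leq\frac12$ then $\mathcal A\subset\mathcal B$, and (ii) if $p>\frac12$ then $\mu_{\boldsymbol p}(\mathcal A\triangle\mathcal B)<(C_p+\eta_p(\epsilon))\,\epsilon$, where $C_p=\frac{16p(1-p)^2}{(2p-1)(3-4p)}$.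
   Context: $[n]=\{1,2,\ldots,n\}$ and $2^{[n]}$ is the family of all subsets of $[n]$. A family $\mathcal A\subset 2^{[n]}$ is $r$-wise intersecting if $A_1\cap A_2\cap\cdots\cap A_r\neq\emptyset$ for all (not necessarily distinct) $A_1,\ldots,A_r\in\mathcal A$. For $\boldsymbol p=(p_1,\ldots,p_n)\in(0,1)^n$ and $A\subset[n]$, $\mu_{\boldsymbol p}(A):=\prod_{i\in A}p_i\prod_{j\in[n]\setminus A}(1-p_j)$, and for a family $\mathcal A\subset 2^{[n]}$, $\mu_{\boldsymbol p}(\mathcal A):=\sum_{A\in\mathcal A}\mu_{\boldsymbol p}(A)$. A star is a family of the form $\{A\in 2^{[n]}: i\in A\}$ for some $i\in[n]$ (its center). $\mathcal A\triangle\mathcal B$ denotes the symmetric difference. *)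

theory Defs
  imports Complex_Main
begin

text \<open>Families of subsets of \<open>[n] = {1..n}\<close> have type \<^typ>\<open>nat set set\<close> and are constrained to be
  subsets of \<open>Pow {1..n}\<close> where they are used; a vector \<open>(p 1, \<dots>, p n)\<close> is a function
  \<^typ>\<open>nat \<Rightarrow> real\<close> of which only the values on \<open>{1..n}\<close> matter.\<close>

definition wise_intersecting :: "nat \<Rightarrow> nat set set \<Rightarrow> bool" where
  "wise_intersecting r \<A> \<longleftrightarrow>
     (\<forall>A :: nat \<Rightarrow> nat set. (\<forall>i\<in>{1..r}. A i \<in> \<A>) \<longrightarrow> (\<Inter>i\<in>{1..r}. A i) \<noteq> {})"

definition mu_set :: "nat \<Rightarrow> (nat \<Rightarrow> real) \<Rightarrow> nat set \<Rightarrow> real" where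
  "mu_set n p A = (\<Prod>i\<in>A. p i) * (\<Prod>j\<in>{1..n} - A. 1 - p j)"

definition mu :: "nat \<Rightarrow> (nat \<Rightarrow> real) \<Rightarrow> nat set set \<Rightarrow> real" where
  "mu n p \<A> = (\<Sum>A\<in>\<A>. mu_set n p A)"

definition star :: "nat \<Rightarrow> nat set set \<Rightarrow> bool" where
  "star n \<B> \<longleftrightarrow> (\<exists>i\<in>{1..n}. \<B> = {A \<in> Pow {1..n}. i \<in> A})"

end

theory Submission
  imports Defs "HOL-Library.FuncSet" "HOL-Analysis.Convex"
begin

text \<open>
  The family is replaced by the indicator function \<open>f\<close> of its up-closure, which is still 3-wise
  intersecting and has measure at least \<open>p - \<epsilon>\<close>. Write \<open>m\<close> for the mean of
  \<open>f\<close> and \<open>q = 1 - p\<close>.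

  \<^bold>\<open>A spectral bound.\<close> For \<open>p \<le> 2/3\<close> there are random sets \<open>A1\<close>, \<open>A2\<close>, \<open>A3\<close>, each \<open>p\<close>-biased, such
  that every element lies in exactly two of them (each pair with probability \<open>p/2\<close>) or in none. They
  never have a common element, so \<open>A1\<close> in the family forces \<open>A2\<close> or \<open>A3\<close> out of it, whence
  \<open>m \<le> 2 P(A1 inside, A2 outside)\<close>. The \<open>p\<close>-biased Fourier basis diagonalises the pair \<open>(A1, A2)\<close>:
  level \<open>k\<close> has eigenvalue \<open>\<rho> ^ k\<close> with \<open>\<rho> = (1 - 2 p) / (2 q)\<close>. For \<open>p > 1/2\<close> the smallest
  eigenvalue is \<open>\<rho>\<close>, attained at level one only; this gives \<open>m \<le> p\<close>, and if \<open>m \<ge> p - \<epsilon>\<close> then the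
  Fourier weight of \<open>f\<close> above level one is \<open>O(\<epsilon>)\<close> (\<open>Hoffman_stability\<close>).

  \<^bold>\<open>One influential element.\<close> For an up-closed family the derivative in direction \<open>i\<close> is
  \<open>0/1\<close>-valued with mean \<open>I\<close>, and Parseval shows that \<open>p q I (1 - I)\<close> is at most the weight above level
  one (\<open>influence_dichotomy\<close>): every influence is near 0 or near 1. Not all of them are near 0. Otherwise
  \<open>f\<close> would be close in \<open>L2\<close> to \<open>m + L\<close> with \<open>L\<close> a sum of small independent terms, so that
  the third moment of \<open>L\<close> is negligible, and comparing \<open>E[f L]\<close> with \<open>E[f f L]\<close> would give
  \<open>(2 m - 1) E[L L] \<approx> 0\<close> (\<open>level_one_weight_of_small_influences\<close>). Hence some \<open>i\<close> has influence near
  1 (\<open>dictator_stability\<close>).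

  \<^bold>\<open>From near to linear, for \<open>p > 1/2\<close>.\<close> Let \<open>a\<close> be the measure of the part of the family avoiding \<open>i\<close>
  and \<open>c\<close> the measure missing from the part containing \<open>i\<close>, both as families on the other elements.
  One set from the first and two from the second have a common element other than \<open>i\<close>, so the coupling
  gives \<open>a \<le> 2 (a c + \<bar>\<rho>\<bar> sqrt (a c))\<close>. With \<open>c\<close> small this bounds \<open>a\<close> by essentially \<open>4 \<rho>\<^sup>2 c\<close>; together
  with \<open>p c = q a + (p - m)\<close> it yields \<open>q a \<le> 2 (p - m)\<close> (\<open>local_stability\<close>). The symmetric difference
  with the star is then at most \<open>5 \<epsilon>\<close>, whereas \<open>C\<^sub>p \<ge> 9\<close>; so \<open>\<eta>\<^sub>p = 0\<close> works.

  \<^bold>\<open>The case \<open>p \<le> 1/2\<close>.\<close> For up-closed families the mean at bias \<open>p powr t\<close>, with \<open>t \<le> 1\<close>, is at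
  least the \<open>t\<close>-th power of the mean at bias \<open>p\<close> (\<open>mean_powr\<close>). Taking \<open>p powr t = 3/5\<close>, a family with
  measure near \<open>p\<close> has measure near \<open>3/5\<close> at bias \<open>3/5\<close>, which produces an \<open>i\<close> as above; returning to
  bias \<open>p\<close>, the sets containing \<open>i\<close> fill more than half of their possible measure. A member avoiding
  \<open>i\<close> would make their traces on it pairwise intersecting, which allows at most half when
  \<open>p \<le> 1/2\<close>. So every member contains \<open>i\<close>.
\<close>

section \<open>Expectation over a biased random subset\<close>

text \<open>Expectations are taken over the subsets of an arbitrary finite set rather than of \<open>{1..n}\<close>, so
  that identities can be proved by adding one element at a time.\<close>
definition mean :: "real \<Rightarrow> 'a set \<Rightarrow> ('a set \<Rightarrow> real) \<Rightarrow> real" where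
  "mean p V f = (\<Sum>A\<in>Pow V. p ^ card A * (1 - p) ^ card (V - A) * f A)"

lemma mean_cong: "(\<And>A. A \<subseteq> V \<Longrightarrow> f A = g A) \<Longrightarrow> mean p V f = mean p V g"
  unfolding mean_def by (intro sum.cong) auto

lemma mean_add: "mean p V (\<lambda>A. f A + g A) = mean p V f + mean p V g"
  unfolding mean_def by (simp add: distrib_left sum.distrib)

lemma mean_diff: "mean p V (\<lambda>A. f A - g A) = mean p V f - mean p V g"
  unfolding mean_def by (simp add: right_diff_distrib sum_subtractf)

lemma mean_cmult: "mean p V (\<lambda>A. c * f A) = c * mean p V f"
  unfolding mean_def by (simp add: sum_distrib_left mult.left_commute)

lemma mean_sum: "mean p V (\<lambda>A. \<Sum>i\<in>I. f i A) = (\<Sum>i\<in>I. mean p V (f i))"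
  unfolding mean_def by (subst sum.swap) (simp add: sum_distrib_left)

lemma mean_mono:
  assumes "0 \<le> p" "p \<le> 1" "\<And>A. A \<subseteq> V \<Longrightarrow> f A \<le> g A"
  shows "mean p V f \<le> mean p V g"
  unfolding mean_def using assms by (intro sum_mono mult_left_mono) auto

lemma mean_empty: "mean p {} f = f {}"
  by (simp add: mean_def)

lemma mean_insert:
  assumes "finite V" "x \<notin> V"
  shows "mean p (insert x V) f = p * mean p V (\<lambda>A. f (insert x A)) + (1 - p) * mean p V f"
proof -
  let ?h = "\<lambda>A. p ^ card A * (1 - p) ^ card (insert x V - A) * f A"
  have inj: "inj_on (insert x) (Pow V)"
    using assms(2) by (auto simp: inj_on_def)
  have out: "?h A = (1 - p) * (p ^ card A * (1 - p) ^ card (V - A) * f A)" if "A \<in> Pow V" for A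
  proof -
    have "insert x V - A = insert x (V - A)" using that assms by auto
    then show ?thesis using assms by simp
  qed
  have ins: "?h (insert x A) = p * (p ^ card A * (1 - p) ^ card (V - A) * f (insert x A))"
    if "A \<in> Pow V" for A
  proof -
    have "insert x V - insert x A = V - A" "x \<notin> A" "finite A"
      using that assms by (auto intro: finite_subset)
    then show ?thesis by simp
  qed
  have "mean p (insert x V) f = sum ?h (Pow V) + sum ?h (insert x ` Pow V)"
    unfolding mean_def Pow_insert using assms by (intro sum.union_disjoint) auto
  also have "sum ?h (insert x ` Pow V) = p * mean p V (\<lambda>A. f (insert x A))"
    unfolding sum.reindex[OF inj] mean_def sum_distrib_left using ins by (intro sum.cong) auto
  also have "sum ?h (Pow V) = (1 - p) * mean p V f"
    unfolding mean_def sum_distrib_left using out by (intro sum.cong) auto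
  finally show ?thesis by simp
qed

lemma mean_const: "finite V \<Longrightarrow> mean p V (\<lambda>_. c) = c"
  by (induction V rule: finite_induct) (auto simp: mean_empty mean_insert algebra_simps)

text \<open>Conditioning on whether \<open>i\<close> is chosen; both conditional functions are again functions on all
  subsets of \<open>V\<close>, so the ground set does not shrink.\<close>
lemma mean_split:
  assumes "finite V" "i \<in> V"
  shows "mean p V f = p * mean p V (\<lambda>A. f (insert i A)) + (1 - p) * mean p V (\<lambda>A. f (A - {i}))"
proof -
  let ?W = "V - {i}"
  have V: "mean p V h = p * mean p ?W (\<lambda>A. h (insert i A)) + (1 - p) * mean p ?W h" for h
    using mean_insert[of ?W i p h] assms by (simp add: insert_absorb)
  have out: "mean p ?W (\<lambda>A. f (A - {i})) = mean p ?W f"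
    by (intro mean_cong arg_cong[of _ _ f]) auto
  have ins: "mean p ?W (\<lambda>A. f (insert i A - {i})) = mean p ?W f"
    by (intro mean_cong arg_cong[of _ _ f]) auto
  have "mean p V (\<lambda>A. f (insert i A)) = mean p ?W (\<lambda>A. f (insert i A))"
    unfolding V[of "\<lambda>A. f (insert i A)"] by (simp add: algebra_simps)
  moreover have "mean p V (\<lambda>A. f (A - {i})) = mean p ?W f"
    unfolding V[of "\<lambda>A. f (A - {i})"] ins out by (simp add: algebra_simps)
  ultimately show ?thesis using V[of f] by simp
qed

lemma mean_Cauchy_Schwarz:
  assumes "0 \<le> p" "p \<le> 1"
  shows "(mean p V (\<lambda>A. f A * g A))\<^sup>2 \<le> mean p V (\<lambda>A. (f A)\<^sup>2) * mean p V (\<lambda>A. (g A)\<^sup>2)"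
proof -
  define w where "w A = p ^ card A * (1 - p) ^ card (V - A)" for A
  have w: "0 \<le> w A" for A using assms by (simp add: w_def)
  have *: "sqrt (w A) * sqrt (w A) = w A" for A using w[of A] by simp
  have **: "(sqrt (w A))\<^sup>2 = w A" for A using w[of A] by simp
  have "(\<Sum>A\<in>Pow V. (sqrt (w A) * f A) * (sqrt (w A) * g A)) = mean p V (\<lambda>A. f A * g A)"
    unfolding mean_def w_def[symmetric]
  proof (intro sum.cong refl)
    fix A
    have "sqrt (w A) * f A * (sqrt (w A) * g A) = (sqrt (w A) * sqrt (w A)) * (f A * g A)"
      by (simp only: mult_ac)
    then show "sqrt (w A) * f A * (sqrt (w A) * g A) = w A * (f A * g A)" unfolding * .
  qed
  moreover have "(\<Sum>A\<in>Pow V. (sqrt (w A) * h A)\<^sup>2) = mean p V (\<lambda>A. (h A)\<^sup>2)" for h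
    unfolding mean_def w_def[symmetric] by (simp add: power_mult_distrib **)
  ultimately show ?thesis
    using Cauchy_Schwarz_ineq_sum[of "\<lambda>A. sqrt (w A) * f A" "\<lambda>A. sqrt (w A) * g A" "Pow V"]
    by simp
qed

section \<open>The biased Fourier basis\<close>

text \<open>The indicator of \<open>i \<in> A\<close>, normalised to mean 0 and variance 1. The products \<open>phi p S\<close> are the
  \<open>p\<close>-biased Walsh functions, and \<open>hat p V f S\<close> is the Fourier coefficient of \<open>f\<close> at \<open>S\<close>.\<close>
definition chi :: "real \<Rightarrow> 'a \<Rightarrow> 'a set \<Rightarrow> real" where
  "chi p i A = (if i \<in> A then sqrt ((1 - p) / p) else - sqrt (p / (1 - p)))"

definition phi :: "real \<Rightarrow> 'a set \<Rightarrow> 'a set \<Rightarrow> real" where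
  "phi p S A = (\<Prod>i\<in>S. chi p i A)"

definition hat :: "real \<Rightarrow> 'a set \<Rightarrow> ('a set \<Rightarrow> real) \<Rightarrow> 'a set \<Rightarrow> real" where
  "hat p V f S = mean p V (\<lambda>A. f A * phi p S A)"

lemma chi_mult_chi:
  assumes "0 < p" "p < 1"
  shows "chi p i A * chi p i B =
    (if i \<in> A \<and> i \<in> B then (1 - p) / p else if i \<notin> A \<and> i \<notin> B then p / (1 - p) else -1)"
proof -
  have "sqrt ((1 - p) / p) * sqrt (p / (1 - p)) = sqrt (((1 - p) / p) * (p / (1 - p)))"
    by (simp only: real_sqrt_mult)
  also have "\<dots> = 1" using assms by simp
  finally have 1: "sqrt ((1 - p) / p) * sqrt (p / (1 - p)) = 1" .
  have 2: "sqrt ((1 - p) / p) * sqrt ((1 - p) / p) = (1 - p) / p"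
     "sqrt (p / (1 - p)) * sqrt (p / (1 - p)) = p / (1 - p)"
    using assms by (simp_all only: real_sqrt_mult_self) auto
  show ?thesis
    unfolding chi_def using 1 2 by (auto simp: mult.commute)
qed

text \<open>The kernel \<open>\<Sum>S. phi p S A * phi p S B\<close> factorises over \<open>V\<close> into \<open>chi p i A * chi p i B + 1\<close>,
  which vanishes as soon as exactly one of \<open>A\<close>, \<open>B\<close> contains \<open>i\<close>. Completeness is all that inversion
  and Parseval need.\<close>
lemma phi_completeness:
  assumes "0 < p" "p < 1" "finite V" "A \<subseteq> V" "B \<subseteq> V"
  shows "p ^ card A * (1 - p) ^ card (V - A) * (\<Sum>S\<in>Pow V. phi p S A * phi p S B) = of_bool (A = B)"
proof -
  have "p ^ card A * (1 - p) ^ card (V - A) = (\<Prod>i\<in>V. if i \<in> A then p else 1 - p)"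
  proof -
    have "V \<inter> {i. i \<in> A} = A" "V \<inter> - {i. i \<in> A} = V - A" using assms by auto
    then show ?thesis using assms(3) by (subst prod.If_cases) auto
  qed
  moreover have "(\<Sum>S\<in>Pow V. phi p S A * phi p S B) = (\<Prod>i\<in>V. chi p i A * chi p i B + 1)"
    by (subst prod_add[OF assms(3)]) (simp add: phi_def prod.distrib)
  moreover have "(\<Prod>i\<in>V. if i \<in> A then p else 1 - p) * (\<Prod>i\<in>V. chi p i A * chi p i B + 1)
    = (\<Prod>i\<in>V. of_bool (i \<in> A \<longleftrightarrow> i \<in> B))"
    unfolding prod.distrib[symmetric] using assms(1,2)
    by (intro prod.cong) (auto simp: chi_mult_chi field_simps)
  moreover have "(\<Prod>i\<in>V. of_bool (i \<in> A \<longleftrightarrow> i \<in> B)) = (of_bool (A = B) :: real)"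
  proof (cases "A = B")
    case False
    then obtain i where "i \<in> V" "\<not> (i \<in> A \<longleftrightarrow> i \<in> B)" using assms by auto
    then have "(\<Prod>i\<in>V. of_bool (i \<in> A \<longleftrightarrow> i \<in> B)) = (0::real)"
      using assms(3) by (subst prod_zero_iff) (auto intro: bexI[of _ i])
    then show ?thesis using False by simp
  qed auto
  ultimately show ?thesis by simp
qed

lemma Fourier_inversion:
  assumes "0 < p" "p < 1" "finite V" "A \<subseteq> V"
  shows "f A = (\<Sum>S\<in>Pow V. hat p V f S * phi p S A)"
proof -
  have "(\<Sum>S\<in>Pow V. hat p V f S * phi p S A) =
    (\<Sum>B\<in>Pow V. (p ^ card B * (1 - p) ^ card (V - B) * (\<Sum>S\<in>Pow V. phi p S B * phi p S A)) * f B)"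
    unfolding hat_def mean_def sum_distrib_left sum_distrib_right
    by (subst sum.swap) (simp add: mult_ac)
  also have "\<dots> = (\<Sum>B\<in>Pow V. of_bool (B = A) * f B)"
    using assms by (intro sum.cong) (auto simp: phi_completeness)
  also have "\<dots> = f A"
    using assms by (simp add: of_bool_def if_distrib[of "\<lambda>x. x * _"] cong: if_cong)
  finally show ?thesis by simp
qed

lemma Parseval:
  assumes "0 < p" "p < 1" "finite V"
  shows "(\<Sum>S\<in>Pow V. hat p V f S * hat p V g S) = mean p V (\<lambda>A. f A * g A)"
proof -
  have "mean p V (\<lambda>A. f A * g A) = mean p V (\<lambda>A. \<Sum>S\<in>Pow V. hat p V f S * (g A * phi p S A))"
  proof (rule mean_cong)
    fix A assume "A \<subseteq> V"
    then have "f A * g A = (\<Sum>S\<in>Pow V. hat p V f S * phi p S A) * g A"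
      using Fourier_inversion[OF assms, of A f] by simp
    then show "f A * g A = (\<Sum>S\<in>Pow V. hat p V f S * (g A * phi p S A))"
      unfolding sum_distrib_right by (simp add: mult_ac)
  qed
  then show ?thesis
    by (simp add: mean_sum mean_cmult hat_def)
qed

lemma hat_empty: "hat p V f {} = mean p V f"
  by (simp add: hat_def phi_def)

lemma hat_singleton: "hat p V f {i} = mean p V (\<lambda>A. f A * chi p i A)"
  by (simp add: hat_def phi_def)

section \<open>Three coupled sets without a common element\<close>

text \<open>The correlation of \<open>chi p i\<close> between two of the coupled sets defined below, hence the
  eigenvalue of the coupling on level one.\<close>
definition rho :: "real \<Rightarrow> real" where
  "rho p = (1 - 2 * p) / (2 * (1 - p))"

definition noise :: "real \<Rightarrow> 'a set \<Rightarrow> ('a set \<Rightarrow> real) \<Rightarrow> ('a set \<Rightarrow> real) \<Rightarrow> real" where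
  "noise p V f g = (\<Sum>S\<in>Pow V. rho p ^ card S * (hat p V f S * hat p V g S))"

text \<open>The coupling labels each element independently: label 0 puts it into none of the three sets,
  label \<open>k \<in> {1, 2, 3}\<close> into the two sets other than the \<open>k\<close>-th. The weights give each set the bias
  \<open>p\<close>, and are nonnegative precisely for \<open>0 \<le> p \<le> 2/3\<close>.\<close>
definition label_wt :: "real \<Rightarrow> nat \<Rightarrow> real" where
  "label_wt p k = (if k = 0 then 1 - 3 * p / 2 else p / 2)"

definition coupled :: "real \<Rightarrow> 'a set \<Rightarrow> (('a \<Rightarrow> nat) \<Rightarrow> real) \<Rightarrow> real" where
  "coupled p V F = (\<Sum>w\<in>V \<rightarrow>\<^sub>E {..<4}. (\<Prod>i\<in>V. label_wt p (w i)) * F w)"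

definition copy :: "'a set \<Rightarrow> nat \<Rightarrow> ('a \<Rightarrow> nat) \<Rightarrow> 'a set" where
  "copy V j w = {i \<in> V. w i \<noteq> 0 \<and> w i \<noteq> j}"

lemma coupled_add: "coupled p V (\<lambda>w. F w + G w) = coupled p V F + coupled p V G"
  unfolding coupled_def by (simp add: distrib_left sum.distrib)

lemma coupled_cmult: "coupled p V (\<lambda>w. c * F w) = c * coupled p V F"
  unfolding coupled_def by (simp add: sum_distrib_left mult.left_commute)

lemma coupled_sum: "coupled p V (\<lambda>w. \<Sum>i\<in>I. F i w) = (\<Sum>i\<in>I. coupled p V (F i))"
  unfolding coupled_def by (subst sum.swap) (simp add: sum_distrib_left)

lemma coupled_prod:
  assumes "finite V"
  shows "coupled p V (\<lambda>w. \<Prod>i\<in>V. h i (w i)) = (\<Prod>i\<in>V. \<Sum>k<4. label_wt p k * h i k)"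
  unfolding coupled_def
  by (subst prod_sum_PiE) (use assms in \<open>auto simp: prod.distrib\<close>)

text \<open>Both Walsh functions are products over \<open>V\<close> and the labels are independent, so the expectation
  is a product over \<open>V\<close>: an element in exactly one of \<open>S\<close>, \<open>T\<close> contributes the mean of \<open>chi\<close>, which is
  0, and an element in both contributes the correlation \<open>rho p\<close>.\<close>
lemma coupled_phi:
  assumes "0 < p" "p < 1" "finite V" "S \<subseteq> V" "T \<subseteq> V"
    and jk: "j \<in> {1, 2, 3}" "k \<in> {1, 2, 3}" "j \<noteq> k"
  shows "coupled p V (\<lambda>w. phi p S (copy V j w) * phi p T (copy V k w)) =
    (if S = T then rho p ^ card S else 0)"
proof -
  define a where "a = sqrt ((1 - p) / p)"
  define b where "b = sqrt (p / (1 - p))"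
  have ab: "a * b = 1" "a * a = (1 - p) / p" "b * b = p / (1 - p)"
    using chi_mult_chi[OF assms(1,2), of 0 "{0}" "{}"] chi_mult_chi[OF assms(1,2), of 0 "{0}" "{0}"]
      chi_mult_chi[OF assms(1,2), of 0 "{}" "{}"]
    by (auto simp: chi_def a_def b_def)
  have pa: "p * a = (1 - p) * b"
  proof -
    have "p * a = p * a * (a * b)" using ab by simp
    also have "\<dots> = p * (a * a) * b" by (simp add: mult_ac)
    also have "\<dots> = (1 - p) * b" unfolding ab using assms by simp
    finally show ?thesis .
  qed
  define c where "c j l = (if l = 0 \<or> l = j then - b else a)" for j l :: nat
  have ext: "phi p U (copy V l w) = (\<Prod>i\<in>V. if i \<in> U then c l (w i) else 1)"
    if "U \<subseteq> V" for U l w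
  proof -
    have "V \<inter> {i. i \<in> U} = U" using that by auto
    then have "(\<Prod>i\<in>V. if i \<in> U then c l (w i) else 1) = (\<Prod>i\<in>U. c l (w i))"
      using assms(3) by (subst prod.If_cases) auto
    also have "\<dots> = phi p U (copy V l w)"
      unfolding phi_def using that
      by (intro prod.cong) (auto simp: chi_def c_def copy_def a_def b_def)
    finally show ?thesis by simp
  qed
  have w1: "(\<Sum>l<4. label_wt p l) = 1"
    by (simp add: label_wt_def eval_nat_numeral lessThan_Suc)
  have wc: "(\<Sum>l<4. label_wt p l * c m l) = 0" if "m \<in> {1, 2, 3}" for m
  proof -
    have "(\<Sum>l<4. label_wt p l * c m l) = p * a - (1 - p) * b"
      using that by (auto simp: label_wt_def c_def eval_nat_numeral lessThan_Suc algebra_simps)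
    then show ?thesis using pa by simp
  qed
  have wcc: "(\<Sum>l<4. label_wt p l * (c j l * c k l)) = rho p"
  proof -
    have "(\<Sum>l<4. label_wt p l * (c j l * c k l))
       = (1 - 3 * p / 2) * (b * b) + p / 2 * (a * a) - p * (a * b)"
      using jk by (auto simp: label_wt_def c_def eval_nat_numeral lessThan_Suc algebra_simps)
    also have "\<dots> = rho p"
      unfolding ab rho_def using assms(1,2) by (simp add: field_simps)
    finally show ?thesis .
  qed
  have "coupled p V (\<lambda>w. phi p S (copy V j w) * phi p T (copy V k w)) =
    (\<Prod>i\<in>V. \<Sum>l<4. label_wt p l * ((if i \<in> S then c j l else 1) * (if i \<in> T then c k l else 1)))"
    unfolding ext[OF assms(4)] ext[OF assms(5)] prod.distrib[symmetric]
    by (rule coupled_prod[OF assms(3)])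
  also have "\<dots> = (\<Prod>i\<in>V. if i \<in> S then (if i \<in> T then rho p else 0) else (if i \<in> T then 0 else 1))"
    using w1 wc[OF jk(1)] wc[OF jk(2)] wcc by (intro prod.cong) auto
  also have "\<dots> = (if S = T then rho p ^ card S else 0)"
  proof (cases "S = T")
    case True
    have "V \<inter> {i. i \<in> T} = T" using assms by auto
    then show ?thesis using True assms(3) by (simp add: prod.If_cases)
  next
    case False
    then obtain i where "i \<in> V" "\<not> (i \<in> S \<longleftrightarrow> i \<in> T)" using assms by auto
    then show ?thesis using False assms(3)
      by (auto simp: prod_zero_iff intro!: bexI[of _ i])
  qed
  finally show ?thesis .
qed

lemma copy_subset: "copy V j w \<subseteq> V"
  by (auto simp: copy_def)

lemma copies_disjoint: "copy V 1 w \<inter> copy V 2 w \<inter> copy V 3 w = {}" if "w \<in> V \<rightarrow>\<^sub>E {..<4}"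
proof -
  have "w i = 0 \<or> w i = 1 \<or> w i = 2 \<or> w i = 3" if "i \<in> V" for i
    using PiE_mem[OF \<open>w \<in> _\<close> that] by auto
  then show ?thesis by (force simp: copy_def)
qed

lemma coupled_pair:
  assumes "0 < p" "p < 1" "finite V"
    and jk: "j \<in> {1, 2, 3}" "k \<in> {1, 2, 3}" "j \<noteq> k"
  shows "coupled p V (\<lambda>w. f (copy V j w) * g (copy V k w)) = noise p V f g"
proof -
  have "coupled p V (\<lambda>w. f (copy V j w) * g (copy V k w)) =
    coupled p V (\<lambda>w. \<Sum>S\<in>Pow V. hat p V f S * (\<Sum>T\<in>Pow V. hat p V g T *
      (phi p S (copy V j w) * phi p T (copy V k w))))"
  proof (rule arg_cong[of _ _ "coupled p V"], rule ext)
    fix w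
    have "f (copy V j w) * g (copy V k w) =
      (\<Sum>S\<in>Pow V. \<Sum>T\<in>Pow V. (hat p V f S * phi p S (copy V j w)) * (hat p V g T * phi p T (copy V k w)))"
      unfolding sum_product[symmetric]
      using Fourier_inversion[OF assms(1-3) copy_subset] by metis
    then show "f (copy V j w) * g (copy V k w) = (\<Sum>S\<in>Pow V. hat p V f S * (\<Sum>T\<in>Pow V. hat p V g T *
      (phi p S (copy V j w) * phi p T (copy V k w))))"
      unfolding sum_distrib_left by (simp add: mult_ac)
  qed
  also have "\<dots> = (\<Sum>S\<in>Pow V. hat p V f S * (\<Sum>T\<in>Pow V. hat p V g T *
      (if S = T then rho p ^ card S else 0)))"
    unfolding coupled_sum coupled_cmult
    using assms by (intro sum.cong arg_cong2[of _ _ _ _ "(*)"] refl coupled_phi) auto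
  also have "\<dots> = noise p V f g"
    unfolding noise_def using assms(3)
    by (simp add: if_distrib[of "\<lambda>x. _ * x"] mult_ac cong: if_cong)
  finally show ?thesis .
qed

text \<open>By Parseval the squares of these coefficients add up to 1, which the coefficient at the empty
  set already contributes.\<close>
lemma hat_one:
  assumes "0 < p" "p < 1" "finite V" "S \<subseteq> V"
  shows "hat p V (\<lambda>_. 1) S = of_bool (S = {})"
proof (cases "S = {}")
  case True
  then show ?thesis using assms by (simp add: hat_empty mean_const)
next
  case False
  have "(\<Sum>T\<in>Pow V. (hat p V (\<lambda>_. 1) T)\<^sup>2) = 1"
    using Parseval[OF assms(1-3), of "\<lambda>_. 1" "\<lambda>_. 1"] mean_const[OF assms(3), of p 1]
    by (simp add: power2_eq_square)
  moreover have "(\<Sum>T\<in>{{}, S}. (hat p V (\<lambda>_. 1) T)\<^sup>2) \<le> (\<Sum>T\<in>Pow V. (hat p V (\<lambda>_. 1) T)\<^sup>2)"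
    using assms by (intro sum_mono2) auto
  ultimately have "(hat p V (\<lambda>_. 1) S)\<^sup>2 \<le> 0"
    using False assms by (simp add: hat_empty mean_const)
  then show ?thesis using False by simp
qed

lemma hat_one_minus:
  assumes "0 < p" "p < 1" "finite V" "S \<subseteq> V"
  shows "hat p V (\<lambda>A. 1 - f A) S = of_bool (S = {}) - hat p V f S"
  using hat_one[OF assms] by (simp add: hat_def left_diff_distrib mean_diff)

lemma coupled_marginal:
  assumes "0 < p" "p < 1" "finite V" "j \<in> {1, 2, 3}"
  shows "coupled p V (\<lambda>w. f (copy V j w)) = mean p V f"
proof -
  define k where "k = (if j = 1 then 2 else 1 :: nat)"
  have k: "k \<in> {1, 2, 3}" "j \<noteq> k" by (auto simp: k_def)
  have "coupled p V (\<lambda>w. f (copy V j w)) = noise p V f (\<lambda>_. 1)"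
    using coupled_pair[OF assms k, of f "\<lambda>_. 1"] by simp
  also have "\<dots> = (\<Sum>S\<in>Pow V. if S = {} then hat p V f {} else 0)"
    unfolding noise_def using assms by (intro sum.cong) (auto simp: hat_one)
  also have "\<dots> = mean p V f"
    using assms by (simp add: hat_empty)
  finally show ?thesis .
qed

text \<open>The coupled sets have no common element, so \<open>f\<close> at the first, \<open>g\<close> at the second and \<open>g\<close> at the
  third are never all 1. Where \<open>f\<close> is 1, one of the two values of \<open>g\<close> is therefore 0, and a union bound
  applies. Using this with \<open>g = f\<close> gives the global spectral bound, and with different \<open>f\<close> and \<open>g\<close>
  the local one.\<close>
lemma mean_le_noise_of_cross_intersecting:
  assumes "0 < p" "p \<le> 2/3" "finite V"
    and f: "\<And>A. A \<subseteq> V \<Longrightarrow> f A \<in> {0, 1}" and g: "\<And>A. A \<subseteq> V \<Longrightarrow> g A \<in> {0, 1}"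
    and cross: "\<And>A B C. \<lbrakk>A \<subseteq> V; B \<subseteq> V; C \<subseteq> V; A \<inter> B \<inter> C = {}\<rbrakk> \<Longrightarrow> f A * g B * g C = 0"
  shows "mean p V f \<le> 2 * noise p V f (\<lambda>A. 1 - g A)"
proof -
  have "mean p V f = coupled p V (\<lambda>w. f (copy V 1 w))"
    using assms by (simp add: coupled_marginal)
  also have "\<dots> \<le> coupled p V (\<lambda>w. f (copy V 1 w) * (1 - g (copy V 2 w)) + f (copy V 1 w) * (1 - g (copy V 3 w)))"
    unfolding coupled_def
  proof (rule sum_mono, rule mult_left_mono)
    fix w assume w: "w \<in> V \<rightarrow>\<^sub>E {..<4::nat}"
    show "0 \<le> (\<Prod>i\<in>V. label_wt p (w i))"
      using assms by (intro prod_nonneg) (auto simp: label_wt_def)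
    show "f (copy V 1 w) \<le> f (copy V 1 w) * (1 - g (copy V 2 w)) + f (copy V 1 w) * (1 - g (copy V 3 w))"
    proof -
      have "x \<le> x * (1 - y) + x * (1 - z)"
        if "x \<in> {0, 1}" "y \<in> {0, 1}" "z \<in> {0, 1}" "x * y * z = 0" for x y z :: real
        using that by auto
      then show ?thesis
        using f[OF copy_subset] g[OF copy_subset] g[OF copy_subset]
          cross[OF copy_subset copy_subset copy_subset copies_disjoint[OF w]] .
    qed
  qed
  also have "\<dots> = 2 * noise p V f (\<lambda>A. 1 - g A)"
    using coupled_pair[of p V 1 2 f "\<lambda>A. 1 - g A"] coupled_pair[of p V 1 3 f "\<lambda>A. 1 - g A"] assms
    by (simp add: coupled_add)
  finally show ?thesis .
qed

section \<open>Nearly maximal measure forces the Fourier weight onto levels 0 and 1\<close>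

definition high_weight :: "real \<Rightarrow> 'a set \<Rightarrow> ('a set \<Rightarrow> real) \<Rightarrow> real" where
  "high_weight p V f = (\<Sum>S | S \<subseteq> V \<and> 2 \<le> card S. (hat p V f S)\<^sup>2)"

lemma high_weight_nonneg: "0 \<le> high_weight p V f"
  by (simp add: high_weight_def sum_nonneg)

lemma sum_Pow_levels:
  fixes F :: "'a set \<Rightarrow> real"
  assumes "finite V"
  shows "sum F (Pow V) = F {} + (\<Sum>i\<in>V. F {i}) + (\<Sum>S | S \<subseteq> V \<and> 2 \<le> card S. F S)"
proof -
  have "Pow V = insert {} ((\<lambda>i. {i}) ` V \<union> {S. S \<subseteq> V \<and> 2 \<le> card S})"
  proof -
    have "S \<in> (\<lambda>i. {i}) ` V" if "S \<subseteq> V" "S \<noteq> {}" "\<not> 2 \<le> card S" for S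
    proof -
      have "finite S" using that(1) assms by (rule finite_subset)
      then have "card S \<noteq> 0" using that(2) by simp
      with that(3) have "card S = 1" by linarith
      then show ?thesis using that by (auto simp: card_1_singleton_iff)
    qed
    then show ?thesis by auto
  qed
  moreover have fin: "finite {S. S \<subseteq> V \<and> 2 \<le> card S}"
    by (rule finite_subset[of _ "Pow V"]) (use assms in auto)
  moreover have "sum F ((\<lambda>i. {i}) ` V) = (\<Sum>i\<in>V. F {i})"
    by (subst sum.reindex) auto
  moreover have "sum F ((\<lambda>i. {i}) ` V \<union> {S. S \<subseteq> V \<and> 2 \<le> card S}) =
      sum F ((\<lambda>i. {i}) ` V) + (\<Sum>S | S \<subseteq> V \<and> 2 \<le> card S. F S)"
    using assms fin by (intro sum.union_disjoint) auto
  moreover have "sum F (insert {} ((\<lambda>i. {i}) ` V \<union> {S. S \<subseteq> V \<and> 2 \<le> card S})) =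
      F {} + sum F ((\<lambda>i. {i}) ` V \<union> {S. S \<subseteq> V \<and> 2 \<le> card S})"
    using assms fin by (intro sum.insert) auto
  ultimately show ?thesis
    by (simp only: add.assoc)
qed

lemma Parseval_levels:
  assumes "0 < p" "p < 1" "finite V" and f: "\<And>A. A \<subseteq> V \<Longrightarrow> f A \<in> {0, 1}"
  shows "mean p V f = (mean p V f)\<^sup>2 + (\<Sum>i\<in>V. (hat p V f {i})\<^sup>2) + high_weight p V f"
proof -
  have "mean p V f = mean p V (\<lambda>A. f A * f A)"
    using f by (intro mean_cong) fastforce
  also have "\<dots> = (\<Sum>S\<in>Pow V. (hat p V f S)\<^sup>2)"
    using Parseval[OF assms(1-3), of f f] by (simp add: power2_eq_square)
  finally show ?thesis
    unfolding sum_Pow_levels[OF assms(3)] high_weight_def by (simp add: hat_empty)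
qed

lemma rho_bounds:
  assumes "1/2 \<le> p" "p \<le> 2/3"
  shows "-1/2 \<le> rho p" "rho p \<le> 0"
  using assms by (auto simp: rho_def field_simps)

text \<open>All eigenvalues \<open>rho p ^ k\<close> with \<open>k \<ge> 2\<close> are at least \<open>rho p / 4\<close>, because \<open>-1/2 \<le> rho p \<le> 0\<close>.
  This gap to the smallest eigenvalue \<open>rho p\<close>, belonging to level one, is what penalises the weight on
  higher levels. Since that weight is nonnegative, the inequality contains the bound \<open>mean p V f \<le> p\<close>
  for \<open>p > 1/2\<close>.\<close>
lemma Hoffman_stability:
  assumes "1/2 \<le> p" "p \<le> 2/3" "finite V"
    and f: "\<And>A. A \<subseteq> V \<Longrightarrow> f A \<in> {0, 1}"
    and cross: "\<And>A B C. \<lbrakk>A \<subseteq> V; B \<subseteq> V; C \<subseteq> V; A \<inter> B \<inter> C = {}\<rbrakk> \<Longrightarrow> f A * f B * f C = 0"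
  shows "3 * (2 * p - 1) * high_weight p V f \<le> 4 * mean p V f * (p - mean p V f)"
proof -
  define m where "m = mean p V f"
  define d where "d = high_weight p V f"
  define s where "s = (\<Sum>i\<in>V. (hat p V f {i})\<^sup>2)"
  define r where "r = rho p"
  have p: "0 < p" "p < 1" using assms by auto
  have r: "-1/2 \<le> r" "r \<le> 0" using rho_bounds[of p] assms by (auto simp: r_def)
  \<comment> \<open>Even powers are nonnegative; for odd \<open>k \<ge> 3\<close> use \<open>r\<^sup>2 \<le> 1/4\<close> once.\<close>
  have pow: "r / 4 \<le> r ^ k" if k: "2 \<le> k" for k
  proof (cases "even k")
    case True
    then have "0 \<le> r ^ k" by (rule zero_le_even_power)
    then show ?thesis using r by linarith
  next
    case False
    then obtain j where j: "k = Suc (2 * j)" by (auto elim: oddE)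
    with k have "1 \<le> j" by auto
    have "r\<^sup>2 \<le> (1/2)\<^sup>2" using r by (intro power2_le_iff_abs_le[THEN iffD2]) auto
    then have r2: "r\<^sup>2 \<le> 1/4" by (simp add: power2_eq_square)
    have "(r\<^sup>2) ^ j \<le> (r\<^sup>2) ^ 1"
      using \<open>1 \<le> j\<close> r2 by (intro power_decreasing) auto
    then have "(r\<^sup>2) ^ j \<le> 1/4" using r2 by simp
    then have "r * (1/4) \<le> r * (r\<^sup>2) ^ j" using r by (intro mult_left_mono_neg) auto
    then show ?thesis by (simp add: j power_mult)
  qed
  have lev: "m = m\<^sup>2 + s + d"
    unfolding m_def s_def d_def by (rule Parseval_levels[OF p assms(3) f])
  have "noise p V f (\<lambda>A. 1 - f A) = (\<Sum>S\<in>Pow V. r ^ card S * (hat p V f S * (of_bool (S = {}) - hat p V f S)))"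
    unfolding noise_def r_def using p assms(3) by (intro sum.cong) (auto simp: hat_one_minus)
  also have "\<dots> = m * (1 - m) - r * s - (\<Sum>S | S \<subseteq> V \<and> 2 \<le> card S. r ^ card S * (hat p V f S)\<^sup>2)"
    unfolding sum_Pow_levels[OF assms(3)] m_def s_def sum_distrib_left diff_conv_add_uminus
      sum_negf[symmetric]
    by (intro arg_cong2[of _ _ _ _ "(+)"] sum.cong) (auto simp: hat_empty power2_eq_square)
  finally have noise: "noise p V f (\<lambda>A. 1 - f A) =
    m * (1 - m) - r * s - (\<Sum>S | S \<subseteq> V \<and> 2 \<le> card S. r ^ card S * (hat p V f S)\<^sup>2)" .
  have "r / 4 * d \<le> (\<Sum>S | S \<subseteq> V \<and> 2 \<le> card S. r ^ card S * (hat p V f S)\<^sup>2)"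
    unfolding d_def high_weight_def sum_distrib_left
    by (intro sum_mono mult_right_mono pow) auto
  moreover have "m \<le> 2 * noise p V f (\<lambda>A. 1 - f A)"
    unfolding m_def by (rule mean_le_noise_of_cross_intersecting[OF p(1) assms(2,3) f f cross])
  ultimately have "m \<le> 2 * (m * (1 - m) - r * s - r / 4 * d)"
  proof -
    have "u \<le> 2 * (x - t)" if "t \<le> y" "u \<le> 2 * (x - y)" for t u x y :: real
      using that by simp
    then show ?thesis
      using \<open>r / 4 * d \<le> _\<close> \<open>m \<le> 2 * noise p V f _\<close>[unfolded noise] by blast
  qed
  also have "\<dots> = 2 * m * (1 - m) * (1 - r) + 3/2 * r * d"
  proof -
    have sm: "s = m * (1 - m) - d" using lev by (simp add: algebra_simps power2_eq_square)
    show ?thesis unfolding sm by (simp add: algebra_simps)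
  qed
  \<comment> \<open>Multiplying by \<open>1 - p\<close> clears the denominator of \<open>rho p\<close>.\<close>
  finally have "(1 - p) * m \<le> (1 - p) * (2 * m * (1 - m) * (1 - r) + 3/2 * r * d)"
    using p by (intro mult_left_mono) auto
  also have "\<dots> = 2 * m * (1 - m) * ((1 - p) - (1 - p) * r) + 3/2 * ((1 - p) * r) * d"
    by (simp add: algebra_simps)
  also have "(1 - p) * r = (1 - 2 * p) / 2"
    using p by (simp add: r_def rho_def field_simps)
  finally show ?thesis unfolding m_def[symmetric] d_def[symmetric] by (simp add: field_simps)
qed

section \<open>Small influences contradict weight on level one\<close>

definition linear_form :: "real \<Rightarrow> 'a set \<Rightarrow> ('a \<Rightarrow> real) \<Rightarrow> 'a set \<Rightarrow> real" where
  "linear_form p V c A = (\<Sum>i\<in>V. c i * chi p i A)"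

lemma chi_relations:
  fixes p :: real
  assumes "0 < p" "p < 1"
  defines "a \<equiv> sqrt ((1 - p) / p)" and "b \<equiv> sqrt (p / (1 - p))" and "r \<equiv> sqrt (p * (1 - p))"
  shows "p * a = r" "(1 - p) * b = r" "r * a = 1 - p" "r * b = p" "a * b = 1"
proof -
  have r2: "r * r = p * (1 - p)" using assms by (simp add: r_def)
  have pos: "0 < r" using assms by (simp add: r_def)
  define q where "q = 1 - p"
  have q: "0 < q" using assms by (simp add: q_def)
  have "a\<^sup>2 = (r / p)\<^sup>2" "b\<^sup>2 = (r / q)\<^sup>2"
    using assms(1,2) q r2 unfolding a_def b_def q_def[symmetric]
    by (simp_all add: power2_eq_square)
  moreover have "0 \<le> a" "0 \<le> b" "0 \<le> r / p" "0 \<le> r / q"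
    using assms(1,2) pos q by (simp_all add: a_def b_def)
  ultimately have ab: "a = r / p" "b = r / q" by (auto intro: power2_eq_imp_eq)
  show "p * a = r" "(1 - p) * b = r" "r * a = 1 - p" "r * b = p" "a * b = 1"
    unfolding ab q_def[symmetric] times_divide_eq_right times_divide_times_eq
    using assms(1) q r2 unfolding q_def[symmetric] by simp_all
qed

lemma mean_linear_form_insert:
  assumes "finite V" "x \<notin> V"
  shows "mean p (insert x V) (\<lambda>A. F (linear_form p (insert x V) c A)) =
    p * mean p V (\<lambda>A. F (linear_form p V c A + c x * sqrt ((1 - p) / p))) +
    (1 - p) * mean p V (\<lambda>A. F (linear_form p V c A - c x * sqrt (p / (1 - p))))"
proof -
  have 1: "linear_form p (insert x V) c (insert x A) = linear_form p V c A + c x * sqrt ((1 - p) / p)" for A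
  proof -
    have "(\<Sum>i\<in>V. c i * chi p i (insert x A)) = (\<Sum>i\<in>V. c i * chi p i A)"
      using assms(2) by (intro sum.cong) (auto simp: chi_def)
    then show ?thesis unfolding linear_form_def using assms by (simp add: chi_def)
  qed
  have 2: "linear_form p (insert x V) c A = linear_form p V c A - c x * sqrt (p / (1 - p))" if "A \<subseteq> V" for A
  proof -
    have "x \<notin> A" using that assms by auto
    then show ?thesis unfolding linear_form_def using assms by (simp add: chi_def)
  qed
  show ?thesis
    unfolding mean_insert[OF assms] 1
    by (intro arg_cong2[of _ _ _ _ "(+)"] arg_cong2[of _ _ _ _ "(*)"] refl mean_cong) (simp add: 2)
qed

text \<open>The terms of the sum are independent with mean 0, so the first three moments are exact and the
  fourth is controlled by the square of the variance. The factor 3 in front of it survives adding a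
  term because the fourth moment of \<open>chi p i\<close>, which is \<open>(1-p)\<^sup>2/p + p\<^sup>2/(1-p)\<close>, is at most
  3 for \<open>1/2 \<le> p \<le> 2/3\<close>.\<close>
lemma linear_form_moments:
  fixes p :: real
  assumes "0 < p" "p < 1" "finite V"
  shows "mean p V (linear_form p V c) = 0"
    and "mean p V (\<lambda>A. (linear_form p V c A)\<^sup>2) = (\<Sum>i\<in>V. (c i)\<^sup>2)"
    and "mean p V (\<lambda>A. linear_form p V c A ^ 3) =
      ((1 - p) * sqrt ((1 - p) / p) - p * sqrt (p / (1 - p))) * (\<Sum>i\<in>V. c i ^ 3)"
    and "\<lbrakk>1/2 \<le> p; p \<le> 2/3\<rbrakk> \<Longrightarrow> mean p V (\<lambda>A. linear_form p V c A ^ 4) \<le> 3 * (\<Sum>i\<in>V. (c i)\<^sup>2)\<^sup>2"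
proof -
  define a where "a = sqrt ((1 - p) / p)"
  define b where "b = sqrt (p / (1 - p))"
  define r where "r = sqrt (p * (1 - p))"
  note rel = chi_relations[OF assms(1,2), folded a_def b_def r_def]
  have a2: "p * a\<^sup>2 = 1 - p" and b2: "(1 - p) * b\<^sup>2 = p"
    using rel by (simp_all add: power2_eq_square mult.assoc[symmetric])
  have a3: "p * a ^ 3 = (1 - p) * a"
    using a2 by (simp add: power3_eq_cube power2_eq_square mult_ac)
  have b3: "(1 - p) * b ^ 3 = p * b"
    using b2 by (simp add: power3_eq_cube power2_eq_square mult_ac)
  define k4 where "k4 = p * a ^ 4 + (1 - p) * b ^ 4"
  let ?P = "\<lambda>W. mean p W (linear_form p W c) = 0 \<and> mean p W (\<lambda>A. (linear_form p W c A)\<^sup>2) = (\<Sum>i\<in>W. (c i)\<^sup>2) \<and>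
     mean p W (\<lambda>A. linear_form p W c A ^ 3) = ((1 - p) * a - p * b) * (\<Sum>i\<in>W. c i ^ 3) \<and>
     (1/2 \<le> p \<and> p \<le> 2/3 \<longrightarrow> mean p W (\<lambda>A. linear_form p W c A ^ 4) \<le> 3 * (\<Sum>i\<in>W. (c i)\<^sup>2)\<^sup>2)"
  have "?P V"
    using assms(3)
  proof (induction V rule: finite_induct)
    case empty
    show ?case by (simp add: mean_empty linear_form_def)
  next
    case (insert x W)
    define L where "L = linear_form p W c"
    define y where "y = c x"
    define s where "s = (\<Sum>i\<in>W. (c i)\<^sup>2)"
    define M3 where "M3 = mean p W (\<lambda>A. L A ^ 3)"
    define M4 where "M4 = mean p W (\<lambda>A. L A ^ 4)"
    have M1: "mean p W L = 0" and M2: "mean p W (\<lambda>A. (L A)\<^sup>2) = s"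
      and M3': "M3 = ((1 - p) * a - p * b) * (\<Sum>i\<in>W. c i ^ 3)"
      using insert.IH by (auto simp: L_def s_def M3_def)
    have s: "(\<Sum>i\<in>insert x W. (c i)\<^sup>2) = s + y\<^sup>2" "(\<Sum>i\<in>insert x W. c i ^ 3) = (\<Sum>i\<in>W. c i ^ 3) + y ^ 3"
      using insert by (auto simp: s_def y_def)
    have lm: "mean p W (\<lambda>A. u) = u" for u by (rule mean_const[OF insert(1)])
    have e1: "mean p W (\<lambda>A. L A + t) = t" for t
      by (simp add: mean_add lm M1)
    have e2: "mean p W (\<lambda>A. (L A + t)\<^sup>2) = s + t\<^sup>2" for t
    proof -
      have "mean p W (\<lambda>A. (L A + t)\<^sup>2) = mean p W (\<lambda>A. (L A)\<^sup>2 + (2 * t * L A + t\<^sup>2))"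
        by (intro mean_cong) (simp add: power2_eq_square algebra_simps)
      then show ?thesis by (simp add: mean_add mean_cmult lm M1 M2)
    qed
    have e3: "mean p W (\<lambda>A. (L A + t) ^ 3) = M3 + 3 * t * s + t ^ 3" for t
    proof -
      have "mean p W (\<lambda>A. (L A + t) ^ 3) = mean p W (\<lambda>A. L A ^ 3 + (3 * t * (L A)\<^sup>2 + (3 * t\<^sup>2 * L A + t ^ 3)))"
        by (intro mean_cong) (simp add: power2_eq_square power3_eq_cube algebra_simps)
      then show ?thesis by (simp add: mean_add mean_cmult lm M1 M2 M3_def)
    qed
    have e4: "mean p W (\<lambda>A. (L A + t) ^ 4) = M4 + 4 * t * M3 + 6 * t\<^sup>2 * s + t ^ 4" for t
    proof -
      have "mean p W (\<lambda>A. (L A + t) ^ 4) = mean p W (\<lambda>A. L A ^ 4 + (4 * t * L A ^ 3 + (6 * t\<^sup>2 * (L A)\<^sup>2 + (4 * t ^ 3 * L A + t ^ 4))))"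
        by (intro mean_cong) (simp add: power2_eq_square power3_eq_cube power4_eq_xxxx algebra_simps)
      then show ?thesis by (simp add: mean_add mean_cmult lm M1 M2 M3_def M4_def)
    qed
    have ins: "mean p (insert x W) (\<lambda>A. F (linear_form p (insert x W) c A)) =
       p * mean p W (\<lambda>A. F (L A + y * a)) + (1 - p) * mean p W (\<lambda>A. F (L A + - (y * b)))" for F
      using mean_linear_form_insert[OF insert(1,2), of p F c] by (simp add: L_def y_def a_def b_def)
    have z: "p * (y * a) = (1 - p) * (y * b)" using rel(1,2) by (simp add: mult.left_commute)
    have q2: "p * (y * a)\<^sup>2 + (1 - p) * (y * b)\<^sup>2 = y\<^sup>2"
    proof -
      have "p * (y * a)\<^sup>2 + (1 - p) * (y * b)\<^sup>2 = y\<^sup>2 * (p * a\<^sup>2 + (1 - p) * b\<^sup>2)"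
        by (simp add: power_mult_distrib algebra_simps)
      then show ?thesis using a2 b2 by simp
    qed
    have "mean p (insert x W) (linear_form p (insert x W) c) = p * (y * a) - (1 - p) * (y * b)"
      using ins[of "\<lambda>t. t"] unfolding e1 by simp
    then have r1: "mean p (insert x W) (linear_form p (insert x W) c) = 0" using z by simp
    have "mean p (insert x W) (\<lambda>A. (linear_form p (insert x W) c A)\<^sup>2) = s + (p * (y * a)\<^sup>2 + (1 - p) * (y * b)\<^sup>2)"
      unfolding ins[of "\<lambda>t. t\<^sup>2"] e2 by (simp add: algebra_simps)
    then have r2: "mean p (insert x W) (\<lambda>A. (linear_form p (insert x W) c A)\<^sup>2) = s + y\<^sup>2" using q2 by simp
    have "mean p (insert x W) (\<lambda>A. (linear_form p (insert x W) c A) ^ 3) =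
       M3 + 3 * s * (p * (y * a) - (1 - p) * (y * b)) + y ^ 3 * (p * a ^ 3 - (1 - p) * b ^ 3)"
      unfolding ins[of "\<lambda>t. t ^ 3"] e3 by (simp add: power_mult_distrib algebra_simps)
    then have r3: "mean p (insert x W) (\<lambda>A. (linear_form p (insert x W) c A) ^ 3) = M3 + y ^ 3 * ((1 - p) * a - p * b)"
      unfolding a3 b3 using z by simp
    have "mean p (insert x W) (\<lambda>A. (linear_form p (insert x W) c A) ^ 4) =
       M4 + 4 * M3 * (p * (y * a) - (1 - p) * (y * b)) + 6 * s * (p * (y * a)\<^sup>2 + (1 - p) * (y * b)\<^sup>2)
        + y ^ 4 * k4"
      unfolding ins[of "\<lambda>t. t ^ 4"] e4 by (simp add: k4_def power_mult_distrib algebra_simps)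
    then have r4: "mean p (insert x W) (\<lambda>A. (linear_form p (insert x W) c A) ^ 4) = M4 + 6 * s * y\<^sup>2 + y ^ 4 * k4"
      unfolding q2 using z by simp
    have "mean p (insert x W) (\<lambda>A. linear_form p (insert x W) c A ^ 4) \<le> 3 * (s + y\<^sup>2)\<^sup>2"
      if pp: "1/2 \<le> p" "p \<le> 2/3"
    proof -
      have "p * a ^ 4 = (1 - p) * a\<^sup>2" "(1 - p) * b ^ 4 = p * b\<^sup>2"
        using a2 b2 by (simp_all add: power4_eq_xxxx power2_eq_square mult_ac)
      moreover have "(1 - p) * a\<^sup>2 \<le> p * a\<^sup>2" using pp by (intro mult_right_mono) auto
      moreover have "p * b\<^sup>2 \<le> (2 * (1 - p)) * b\<^sup>2" using pp by (intro mult_right_mono) auto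
      moreover have "(2 * (1 - p)) * b\<^sup>2 = 2 * p" by (simp only: mult.assoc b2)
      ultimately have "k4 \<le> (1 - p) + 2 * p" unfolding k4_def using a2 by linarith
      then have "k4 \<le> 3" using pp by simp
      then have "y ^ 4 * k4 \<le> y ^ 4 * 3" by (intro mult_left_mono) auto
      moreover have "M4 \<le> 3 * s\<^sup>2" using insert.IH pp by (auto simp: M4_def L_def s_def)
      ultimately show ?thesis
        unfolding r4 by (simp add: power2_eq_square power4_eq_xxxx algebra_simps)
    qed
    then show ?case
      unfolding s r1 r2 r3 M3' by (auto simp: algebra_simps)
  qed
  then show "mean p V (linear_form p V c) = 0"
    and "mean p V (\<lambda>A. (linear_form p V c A)\<^sup>2) = (\<Sum>i\<in>V. (c i)\<^sup>2)"
    and "mean p V (\<lambda>A. linear_form p V c A ^ 3) =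
      ((1 - p) * sqrt ((1 - p) / p) - p * sqrt (p / (1 - p))) * (\<Sum>i\<in>V. c i ^ 3)"
    and "\<lbrakk>1/2 \<le> p; p \<le> 2/3\<rbrakk> \<Longrightarrow> mean p V (\<lambda>A. linear_form p V c A ^ 4) \<le> 3 * (\<Sum>i\<in>V. (c i)\<^sup>2)\<^sup>2"
    by (auto simp: a_def b_def)
qed

text \<open>Split \<open>f = m + L + e\<close> with \<open>L\<close> the level-one part and \<open>e\<close> of squared norm \<open>d\<close>. Since \<open>f * f = f\<close>,
  also \<open>E[f f L] = E[f L] = s\<close>. Replacing both factors \<open>f\<close> in turn by \<open>m + L\<close> costs at most
  \<open>sqrt d * (sqrt s + 2 * s)\<close> by Cauchy-Schwarz (the fourth moment of \<open>L\<close> enters here), and leaves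
  \<open>2 * m * s\<close> plus the third moment of \<open>L\<close>. The latter is a multiple of the sum of the cubes of the
  coefficients, which is small compared with \<open>s\<close> when all coefficients are small.

  The factor \<open>2 * m - 1\<close> on the left is why this works only for \<open>p\<close> away from \<open>1/2\<close>: at \<open>1/2\<close> the
  values 0 and 1 are symmetric about the mean and the third moment gives no information.\<close>
lemma level_one_weight_of_small_influences:
  assumes "1/2 \<le> p" "p \<le> 2/3" "finite V"
    and f: "\<And>A. A \<subseteq> V \<Longrightarrow> f A \<in> {0, 1}"
    and c: "\<And>i. i \<in> V \<Longrightarrow> 0 \<le> hat p V f {i}"
       "\<And>i. i \<in> V \<Longrightarrow> hat p V f {i} \<le> t * sqrt (p * (1 - p))"
  defines "m \<equiv> mean p V f" and "s \<equiv> (\<Sum>i\<in>V. (hat p V f {i})\<^sup>2)" and "d \<equiv> high_weight p V f"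
  shows "(2 * m - 1) * s \<le> t * (2 * p - 1) * s + sqrt d * (sqrt s + 2 * s)"
proof -
  have p: "0 < p" "p < 1" using assms by auto
  define c where "c i = hat p V f {i}" for i
  define L where "L = linear_form p V c"
  define e where "e A = f A - m - L A" for A
  define r where "r = sqrt (p * (1 - p))"
  define k where "k = (1 - p) * sqrt ((1 - p) / p) - p * sqrt (p / (1 - p))"
  have s: "s = (\<Sum>i\<in>V. (c i)\<^sup>2)" by (simp add: s_def c_def)
  have s0: "0 \<le> s" by (simp add: s sum_nonneg)
  have d0: "0 \<le> d" by (simp add: d_def high_weight_nonneg)
  have lm: "mean p V (\<lambda>A. u) = u" for u by (rule mean_const[OF assms(3)])
  have L1: "mean p V L = 0" and L2: "mean p V (\<lambda>A. (L A)\<^sup>2) = s"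
    and L3: "mean p V (\<lambda>A. L A ^ 3) = k * (\<Sum>i\<in>V. c i ^ 3)"
    and L4: "mean p V (\<lambda>A. L A ^ 4) \<le> 3 * s\<^sup>2"
    using linear_form_moments[OF p assms(3), of c] assms(1,2) by (auto simp: L_def s k_def)
  have fL: "mean p V (\<lambda>A. f A * L A) = s"
  proof -
    have "mean p V (\<lambda>A. f A * L A) = mean p V (\<lambda>A. \<Sum>i\<in>V. c i * (f A * chi p i A))"
      unfolding L_def linear_form_def sum_distrib_left by (intro mean_cong sum.cong) (auto simp: mult_ac)
    also have "\<dots> = (\<Sum>i\<in>V. c i * hat p V f {i})"
      by (simp add: mean_sum mean_cmult hat_singleton)
    finally show ?thesis by (simp add: s c_def power2_eq_square)
  qed
  have f2: "f A * f A = f A" if "A \<subseteq> V" for A using f[OF that] by auto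
  have e2: "mean p V (\<lambda>A. (e A)\<^sup>2) = d"
  proof -
    have "mean p V (\<lambda>A. (e A)\<^sup>2) =
        mean p V (\<lambda>A. (1 - 2 * m) * f A + (m\<^sup>2 + ((L A)\<^sup>2 + (2 * m * L A + (-2) * (f A * L A)))))"
    proof (intro mean_cong)
      fix A assume "A \<subseteq> V"
      have "(e A)\<^sup>2 = f A * f A + (- 2 * m * f A + (m\<^sup>2 + ((L A)\<^sup>2 + (2 * m * L A + (-2) * (f A * L A)))))"
        by (simp add: e_def power2_eq_square algebra_simps)
      then show "(e A)\<^sup>2 = (1 - 2 * m) * f A + (m\<^sup>2 + ((L A)\<^sup>2 + (2 * m * L A + (-2) * (f A * L A))))"
        unfolding f2[OF \<open>A \<subseteq> V\<close>] by (simp add: algebra_simps)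
    qed
    also have "\<dots> = (1 - 2 * m) * m + (m\<^sup>2 + (s + (2 * m * 0 + (-2) * s)))"
      unfolding mean_add mean_cmult lm L1 L2 fL m_def[symmetric] ..
    also have "\<dots> = m - m\<^sup>2 - s" by (simp add: algebra_simps power2_eq_square)
    also have "\<dots> = d"
      using Parseval_levels[OF p assms(3), of f, OF f] by (simp add: m_def s_def d_def)
    finally show ?thesis .
  qed
  have eL: "mean p V (\<lambda>A. e A * L A) = 0"
  proof -
    have "mean p V (\<lambda>A. e A * L A) = mean p V (\<lambda>A. f A * L A + ((-m) * L A + (-1) * (L A)\<^sup>2))"
      by (intro mean_cong) (simp add: e_def power2_eq_square algebra_simps)
    then show ?thesis unfolding mean_add mean_cmult fL L1 L2 by simp
  qed
  have CS: "\<bar>mean p V (\<lambda>A. e A * g A)\<bar> \<le> sqrt d * sqrt (mean p V (\<lambda>A. (g A)\<^sup>2))" for g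
    unfolding real_sqrt_mult[symmetric] e2[symmetric]
    using mean_Cauchy_Schwarz[of p V e g] p by (intro real_le_rsqrt) (auto simp: abs_le_square_iff)
  have "s = mean p V (\<lambda>A. e A * (f A * L A) + (e A * (L A)\<^sup>2 + (m * (e A * L A) +
      (m\<^sup>2 * L A + (2 * m * (L A)\<^sup>2 + L A ^ 3)))))"
    unfolding fL[symmetric]
  proof (intro mean_cong)
    fix A assume "A \<subseteq> V"
    have "f A * L A = f A * f A * L A" using f2[OF \<open>A \<subseteq> V\<close>] by simp
    then show "f A * L A = e A * (f A * L A) + (e A * (L A)\<^sup>2 + (m * (e A * L A) +
      (m\<^sup>2 * L A + (2 * m * (L A)\<^sup>2 + L A ^ 3))))"
      by (simp add: e_def power2_eq_square power3_eq_cube algebra_simps)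
  qed
  then have "s = mean p V (\<lambda>A. e A * (f A * L A)) + mean p V (\<lambda>A. e A * (L A)\<^sup>2)
      + 2 * m * s + k * (\<Sum>i\<in>V. c i ^ 3)"
    unfolding mean_add mean_cmult eL L1 L2 L3 by simp
  moreover have "- mean p V (\<lambda>A. e A * (f A * L A)) \<le> sqrt d * sqrt s"
  proof -
    have "mean p V (\<lambda>A. (f A * L A)\<^sup>2) \<le> mean p V (\<lambda>A. (L A)\<^sup>2)"
    proof (rule mean_mono)
      fix A assume "A \<subseteq> V"
      then have "f A = 0 \<or> f A = 1" using f by blast
      then show "(f A * L A)\<^sup>2 \<le> (L A)\<^sup>2" by auto
    qed (use p in auto)
    then have "sqrt d * sqrt (mean p V (\<lambda>A. (f A * L A)\<^sup>2)) \<le> sqrt d * sqrt s"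
      unfolding L2 using d0 by (intro mult_left_mono real_sqrt_le_mono) auto
    then show ?thesis using CS[of "\<lambda>A. f A * L A"] by linarith
  qed
  moreover have "- mean p V (\<lambda>A. e A * (L A)\<^sup>2) \<le> sqrt d * (2 * s)"
  proof -
    have "mean p V (\<lambda>A. ((L A)\<^sup>2)\<^sup>2) \<le> (2 * s)\<^sup>2"
    proof -
      have "mean p V (\<lambda>A. ((L A)\<^sup>2)\<^sup>2) = mean p V (\<lambda>A. L A ^ 4)"
        by (intro mean_cong) (simp add: power2_eq_square power4_eq_xxxx)
      also have "\<dots> \<le> (2 * s)\<^sup>2"
        using L4 by (rule order_trans) (simp add: power_mult_distrib)
      finally show ?thesis .
    qed
    then have "sqrt (mean p V (\<lambda>A. ((L A)\<^sup>2)\<^sup>2)) \<le> 2 * s"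
      using s0 by (intro real_le_lsqrt) auto
    then have "sqrt d * sqrt (mean p V (\<lambda>A. ((L A)\<^sup>2)\<^sup>2)) \<le> sqrt d * (2 * s)"
      using d0 by (intro mult_left_mono) auto
    then show ?thesis using CS[of "\<lambda>A. (L A)\<^sup>2"] by linarith
  qed
  moreover have "- k * (\<Sum>i\<in>V. c i ^ 3) \<le> t * (2 * p - 1) * s"
  proof -
    \<comment> \<open>\<open>k\<close> is the third moment of a single \<open>chi\<close>; the factor \<open>r\<close> in the bound on the coefficients
      turns it into \<open>1 - 2 * p\<close>.\<close>
    have "r * k = (1 - p) * (r * sqrt ((1 - p) / p)) - p * (r * sqrt (p / (1 - p)))"
      by (simp add: k_def algebra_simps)
    also have "\<dots> = (1 - p) * (1 - p) - p * p"
      using chi_relations(3,4)[OF p] by (simp add: r_def)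
    also have "\<dots> = - (2 * p - 1)" by (simp add: algebra_simps)
    finally have rk: "r * (- k) = 2 * p - 1" by simp
    have r0: "0 < r" using p by (simp add: r_def)
    have "0 \<le> r * (- k)" unfolding rk using assms(1) by simp
    then have k0: "0 \<le> - k" using r0 by (simp add: zero_le_mult_iff mult_le_0_iff)
    have "(\<Sum>i\<in>V. c i ^ 3) \<le> (\<Sum>i\<in>V. t * r * (c i)\<^sup>2)"
    proof (rule sum_mono)
      fix i assume "i \<in> V"
      then have "c i \<le> t * r" using c(2) by (simp add: c_def r_def)
      then have "c i * (c i)\<^sup>2 \<le> t * r * (c i)\<^sup>2" by (intro mult_right_mono) auto
      then show "c i ^ 3 \<le> t * r * (c i)\<^sup>2" by (simp add: power3_eq_cube power2_eq_square mult_ac)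
    qed
    then have "- k * (\<Sum>i\<in>V. c i ^ 3) \<le> - k * (t * r * s)"
      unfolding s sum_distrib_left[symmetric] using k0 by (intro mult_left_mono) auto
    also have "\<dots> = t * (r * (- k)) * s" by (simp add: mult_ac)
    finally show ?thesis unfolding rk .
  qed
  ultimately show ?thesis by (simp add: algebra_simps)
qed

section \<open>Influences of an up-closed family\<close>

definition dderiv :: "'a \<Rightarrow> ('a set \<Rightarrow> real) \<Rightarrow> 'a set \<Rightarrow> real" where
  "dderiv i f A = f (insert i A) - f (A - {i})"

lemma hat_dderiv:
  assumes "0 < p" "p < 1" "finite V" "i \<in> V" "i \<in> S" "S \<subseteq> V"
  shows "hat p V f S = sqrt (p * (1 - p)) * hat p V (dderiv i f) (S - {i})"
proof -
  define r where "r = sqrt (p * (1 - p))"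
  have S: "finite S" using assms finite_subset by blast
  have phi: "phi p S B = chi p i B * phi p (S - {i}) B" for B
    unfolding phi_def using assms(5) S by (rule prod.remove[rotated])
  have phi1: "phi p (S - {i}) (insert i A) = phi p (S - {i}) A"
    and phi2: "phi p (S - {i}) (A - {i}) = phi p (S - {i}) A" for A
    unfolding phi_def by (intro prod.cong; auto simp: chi_def)+
  have "hat p V f S =
      p * mean p V (\<lambda>A. sqrt ((1 - p) / p) * (f (insert i A) * phi p (S - {i}) A)) +
      (1 - p) * mean p V (\<lambda>A. (- sqrt (p / (1 - p))) * (f (A - {i}) * phi p (S - {i}) A))"
  proof -
    have "hat p V f S = p * mean p V (\<lambda>A. f (insert i A) * phi p S (insert i A)) +
        (1 - p) * mean p V (\<lambda>A. f (A - {i}) * phi p S (A - {i}))"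
      unfolding hat_def by (rule mean_split[OF assms(3,4)])
    then show ?thesis
      unfolding phi phi1 phi2 by (simp add: chi_def mult_ac)
  qed
  also have "\<dots> = (p * sqrt ((1 - p) / p)) * mean p V (\<lambda>A. f (insert i A) * phi p (S - {i}) A)
     - ((1 - p) * sqrt (p / (1 - p))) * mean p V (\<lambda>A. f (A - {i}) * phi p (S - {i}) A)"
    unfolding mean_cmult by simp
  also have "\<dots> = r * hat p V (dderiv i f) (S - {i})"
  proof -
    have "hat p V (dderiv i f) (S - {i}) = mean p V (\<lambda>A. f (insert i A) * phi p (S - {i}) A)
       - mean p V (\<lambda>A. f (A - {i}) * phi p (S - {i}) A)"
      by (simp add: hat_def dderiv_def left_diff_distrib mean_diff)
    then show ?thesis
      unfolding chi_relations[OF assms(1,2)] r_def by (simp only: right_diff_distrib)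
  qed
  finally show ?thesis unfolding r_def .
qed

lemma dderiv_dderiv: "dderiv i (dderiv i f) = (\<lambda>_. 0)"
  by (auto simp: dderiv_def fun_eq_iff)

text \<open>The coefficients of the derivative are, up to the factor \<open>sqrt (p * (1 - p))\<close>, the coefficients
  of \<open>f\<close> at the sets containing \<open>i\<close>. As the derivative is \<open>0/1\<close>-valued, \<open>I * (1 - I)\<close> is its variance,
  that is, its weight on nonempty sets, and these correspond to sets of size at least 2 for \<open>f\<close>.\<close>
lemma influence_dichotomy:
  assumes "0 < p" "p < 1" "finite V" "i \<in> V"
    and D: "\<And>A. A \<subseteq> V \<Longrightarrow> dderiv i f A \<in> {0, 1}"
  defines "I \<equiv> mean p V (dderiv i f)"
  shows "p * (1 - p) * (I * (1 - I)) \<le> high_weight p V f"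
proof -
  define r where "r = sqrt (p * (1 - p))"
  have r2: "r\<^sup>2 = p * (1 - p)" using assms by (simp add: r_def)
  let ?h = "hat p V (dderiv i f)"
  let ?W = "V - {i}"
  \<comment> \<open>The derivative does not depend on \<open>i\<close>, so its own derivative vanishes.\<close>
  have zero: "?h T = 0" if "T \<subseteq> V" "i \<in> T" for T
    unfolding hat_dderiv[OF assms(1-4) that(2,1)] dderiv_dderiv by (simp add: hat_def mean_def)
  have "I = mean p V (\<lambda>A. dderiv i f A * dderiv i f A)"
    unfolding I_def
  proof (rule mean_cong)
    fix A assume "A \<subseteq> V"
    then have "dderiv i f A \<in> {0, 1}" by (rule D)
    then show "dderiv i f A = dderiv i f A * dderiv i f A" by auto
  qed
  also have "\<dots> = (\<Sum>T\<in>Pow V. (?h T)\<^sup>2)"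
    using Parseval[OF assms(1-3)] by (simp add: power2_eq_square)
  also have "\<dots> = (\<Sum>T\<in>Pow ?W. (?h T)\<^sup>2)"
    using assms(3) zero by (intro sum.mono_neutral_right) auto
  also have "\<dots> = (?h {})\<^sup>2 + (\<Sum>T\<in>Pow ?W - {{}}. (?h T)\<^sup>2)"
    using assms(3) by (intro sum.remove) auto
  finally have I: "I * (1 - I) = (\<Sum>T\<in>Pow ?W - {{}}. (?h T)\<^sup>2)"
    by (simp add: hat_empty I_def[symmetric] power2_eq_square algebra_simps)
  have inj: "inj_on (insert i) (Pow ?W - {{}})"
    by (auto simp: inj_on_def)
  have "p * (1 - p) * (I * (1 - I)) = (\<Sum>T\<in>Pow ?W - {{}}. (hat p V f (insert i T))\<^sup>2)"
    unfolding I sum_distrib_left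
  proof (intro sum.cong refl)
    fix T assume "T \<in> Pow ?W - {{}}"
    then have "insert i T \<subseteq> V" "insert i T - {i} = T" using assms(4) by auto
    then show "p * (1 - p) * (?h T)\<^sup>2 = (hat p V f (insert i T))\<^sup>2"
      using hat_dderiv[OF assms(1-4) insertI1, of T f] r2
      by (simp add: power_mult_distrib r_def)
  qed
  also have "\<dots> = (\<Sum>S\<in>insert i ` (Pow ?W - {{}}). (hat p V f S)\<^sup>2)"
    by (simp add: sum.reindex[OF inj])
  also have "\<dots> \<le> high_weight p V f"
    unfolding high_weight_def
  proof (rule sum_mono2)
    show "insert i ` (Pow ?W - {{}}) \<subseteq> {S. S \<subseteq> V \<and> 2 \<le> card S}"
    proof
      fix S assume "S \<in> insert i ` (Pow ?W - {{}})"
      then obtain T where T: "S = insert i T" "T \<subseteq> ?W" "T \<noteq> {}" by blast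
      then have "finite T" using assms(3) by (meson finite_Diff finite_subset)
      moreover have "i \<notin> T" using T by blast
      ultimately have "card S = Suc (card T)" "card T \<noteq> 0" using T by simp_all
      then show "S \<in> {S. S \<subseteq> V \<and> 2 \<le> card S}" using T assms(4) by auto
    qed
  qed (use assms(3) in auto)
  finally show ?thesis .
qed

text \<open>Up-closed 3-wise intersecting families of subsets of \<open>V\<close>, as indicator functions.\<close>
definition up_intersecting :: "'a set \<Rightarrow> ('a set \<Rightarrow> real) \<Rightarrow> bool" where
  "up_intersecting V f \<longleftrightarrow>
    (\<forall>A\<subseteq>V. f A \<in> {0, 1}) \<and>
    (\<forall>B\<subseteq>V. \<forall>A\<subseteq>B. f A \<le> f B) \<and>
    (\<forall>A\<subseteq>V. \<forall>B\<subseteq>V. \<forall>C\<subseteq>V. A \<inter> B \<inter> C = {} \<longrightarrow> f A * f B * f C = 0)"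

text \<open>With \<open>s = 2 * p - 1\<close> and \<open>\<epsilon> = s * D\<close>, the weight above level one is at most \<open>D\<close>. The bound
  \<open>D \<le> p * (1 - p) * t / 4\<close> leaves no influence strictly between \<open>t\<close> and \<open>1 - t\<close>, and
  \<open>D \<le> s\<^sup>2 / 900\<close> excludes that all of them are at most \<open>t \<le> 1/4\<close>.\<close>
lemma dictator_stability:
  assumes "1/2 < p" "p \<le> 2/3" "0 < t" "t \<le> 1/4"
  shows "\<exists>\<epsilon>>0. \<forall>(V :: 'a set) f. finite V \<longrightarrow> up_intersecting V f \<longrightarrow> p - \<epsilon> \<le> mean p V f \<longrightarrow>
    (\<exists>i\<in>V. 1 - t \<le> mean p V (dderiv i f))"
proof -
  define s where "s = 2 * p - 1"
  have s: "0 < s" "s \<le> 1/3" using assms by (auto simp: s_def)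
  define D where "D = min (s\<^sup>2 / 900) (p * (1 - p) * t / 4)"
  have p: "0 < p" "p < 1" using assms by auto
  have D: "0 < D" "D \<le> s\<^sup>2 / 900" "D \<le> p * (1 - p) * t / 4" using s assms p by (auto simp: D_def)
  have "s * s \<le> 1 * 1" using s by (intro mult_mono) auto
  then have D9: "D \<le> 1 / 900" using D by (simp add: power2_eq_square)
  define \<epsilon> where "\<epsilon> = s * D"
  have e0: "0 < \<epsilon>" using s D by (simp add: \<epsilon>_def)
  have "s * D \<le> s * (1 / 900)" using s D9 by (intro mult_left_mono) auto
  then have es: "\<epsilon> \<le> s / 900" by (simp add: \<epsilon>_def)
  have "\<exists>i\<in>V. 1 - t \<le> mean p V (dderiv i f)"
    if V: "finite V" and up: "up_intersecting V f" and m: "p - \<epsilon> \<le> mean p V f" for V :: "'a set" and f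
  proof (rule ccontr)
    assume neg: "\<not> (\<exists>i\<in>V. 1 - t \<le> mean p V (dderiv i f))"
    have f: "f A \<in> {0, 1}" if "A \<subseteq> V" for A
      using up[unfolded up_intersecting_def, THEN conjunct1, rule_format, OF that] .
    have mono: "f A \<le> f B" if "A \<subseteq> B" "B \<subseteq> V" for A B
      using up[unfolded up_intersecting_def, THEN conjunct2, THEN conjunct1, rule_format, OF that(2,1)] .
    have cross: "f A * f B * f C = 0" if "A \<subseteq> V" "B \<subseteq> V" "C \<subseteq> V" "A \<inter> B \<inter> C = {}" for A B C
      using up[unfolded up_intersecting_def, THEN conjunct2, THEN conjunct2, rule_format, OF that] .
    define m where "m = mean p V f"
    define d where "d = high_weight p V f"
    define q where "q = (\<Sum>i\<in>V. (hat p V f {i})\<^sup>2)"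
    have d0: "0 \<le> d" by (simp add: d_def high_weight_nonneg)
    have hoff: "3 * s * d \<le> 4 * m * (p - m)"
      unfolding s_def d_def m_def using assms by (intro Hoffman_stability V f cross) auto
    have mp: "m \<le> p" "0 \<le> m"
    proof -
      show m0: "0 \<le> m" using m es s by (simp add: m_def s_def)
      have "0 \<le> 4 * m * (p - m)" using hoff s d0 by (smt (verit) mult_nonneg_nonneg)
      then show "m \<le> p" using m0 p by (auto simp: zero_le_mult_iff)
    qed
    have "4 * m * (p - m) \<le> 4 * (2/3) * \<epsilon>"
      using mp m assms by (intro mult_mono) (auto simp: m_def)
    then have "3 * s * d \<le> 3 * \<epsilon>" using hoff e0 by linarith
    then have dD: "d \<le> D" using s by (simp add: \<epsilon>_def)
    have dderiv: "dderiv i f A \<in> {0, 1}" if "i \<in> V" "A \<subseteq> V" for i A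
    proof -
      have "A - {i} \<subseteq> V" "insert i A \<subseteq> V" "A - {i} \<subseteq> insert i A" using that by auto
      then have "f (A - {i}) \<in> {0, 1}" "f (insert i A) \<in> {0, 1}" "f (A - {i}) \<le> f (insert i A)"
        using f mono by blast+
      then show ?thesis by (auto simp: dderiv_def)
    qed
    have infl: "0 \<le> mean p V (dderiv i f)" "mean p V (dderiv i f) \<le> t" if i: "i \<in> V" for i
    proof -
      define I where "I = mean p V (dderiv i f)"
      have "0 \<le> dderiv i f A" if "A \<subseteq> V" for A
        using dderiv[OF i that] by auto
      then have "mean p V (\<lambda>_. 0) \<le> I"
        unfolding I_def using p by (intro mean_mono) simp_all
      then have I0: "0 \<le> I" by (simp add: mean_const V)
      have I1: "I < 1 - t" using neg i by (auto simp: I_def)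
      have "I \<le> t"
      proof (rule ccontr)
        assume "\<not> I \<le> t"
        then have "t * (1 - t) < I * (1 - I)"
        proof -
          have "0 < (I - t) * (1 - t - I)" using I1 \<open>\<not> I \<le> t\<close> by (intro mult_pos_pos) auto
          then show ?thesis by (simp add: algebra_simps)
        qed
        moreover have "t * (3/4) \<le> t * (1 - t)" using assms by (intro mult_left_mono) auto
        ultimately have "t / 4 < I * (1 - I)" using assms by linarith
        then have "p * (1 - p) * (t / 4) < p * (1 - p) * (I * (1 - I))"
          using p by (intro mult_strict_left_mono) auto
        also have "\<dots> \<le> d" unfolding I_def d_def by (rule influence_dichotomy[OF p V i dderiv[OF i]])
        finally show False using dD D(3) by simp
      qed
      then show "0 \<le> mean p V (dderiv i f)" "mean p V (dderiv i f) \<le> t" using I0 by (auto simp: I_def)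
    qed
    have hat: "hat p V f {i} = sqrt (p * (1 - p)) * mean p V (dderiv i f)" if "i \<in> V" for i
      using hat_dderiv[OF p V that, of "{i}" f] that by (simp add: hat_empty)
    have main: "(2 * m - 1) * q \<le> t * s * q + sqrt d * (sqrt q + 2 * q)"
      unfolding m_def q_def d_def s_def
    proof (rule level_one_weight_of_small_influences)
      show "0 \<le> hat p V f {i}" if "i \<in> V" for i
        using that infl(1)[OF that] p by (simp add: hat)
      show "hat p V f {i} \<le> t * sqrt (p * (1 - p))" if "i \<in> V" for i
        using that infl(2)[OF that] p by (simp add: hat mult.commute mult_left_mono)
    qed (use assms V f in auto)
    have q: "m = m\<^sup>2 + q + d"
      unfolding m_def q_def d_def by (rule Parseval_levels[OF p V f])
    have q9: "1/9 \<le> q"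
    proof -
      have "2/9 - 1/100 \<le> m * (1 - m)"
      proof -
        have "1/2 - 1/900 \<le> m" "m \<le> 2/3" using m mp es s assms by (auto simp: m_def s_def)
        then have "0 \<le> (m - (1/2 - 1/900)) * (2/3 - m)" by (intro mult_nonneg_nonneg) auto
        then show ?thesis using \<open>m \<le> 2/3\<close> \<open>1/2 - 1/900 \<le> m\<close> by (simp add: field_simps)
      qed
      then show ?thesis using q dD D9 by (simp add: power2_eq_square algebra_simps)
    qed
    have sq: "1/3 \<le> sqrt q" using q9 by (intro real_le_rsqrt) (auto simp: power2_eq_square)
    have sd: "sqrt d \<le> s / 30"
      using dD D(2) s by (intro real_le_lsqrt) (auto simp: power2_eq_square)
    have "sqrt q \<le> 3 * q"
    proof -
      have "1/3 * sqrt q \<le> sqrt q * sqrt q" using sq q9 by (intro mult_right_mono) auto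
      moreover have "sqrt q * sqrt q = q" using q9 by (intro real_sqrt_mult_self[THEN trans]) linarith
      ultimately show ?thesis by simp
    qed
    then have "sqrt d * (sqrt q + 2 * q) \<le> s / 30 * (5 * q)"
      using sd s q9 d0 by (intro mult_mono) auto
    moreover have "t * s * q \<le> 1/4 * s * q" using assms s q9 by (intro mult_right_mono) auto
    moreover have "(3/4 * s) * q \<le> (2 * m - 1) * q"
      using m es q9 s by (intro mult_right_mono) (auto simp: m_def s_def)
    \<comment> \<open>The right-hand side is \<open>(1/4 + 1/6) s q\<close>, and \<open>1/4 + 1/6 < 3/4\<close>.\<close>
    ultimately have "(3/4 * s) * q \<le> 1/4 * s * q + s / 30 * (5 * q)" using main by linarith
    then have "s * q \<le> 0" by (simp add: mult.commute)
    moreover have "0 < s * q" using s q9 by (intro mult_pos_pos) auto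
    ultimately show False by simp
  qed
  with e0 show ?thesis by blast
qed

section \<open>Families close to a star\<close>

text \<open>Let \<open>h\<close> and \<open>g\<close> describe the members avoiding and containing \<open>i\<close>, with \<open>i\<close> removed. Members
  \<open>A - {i}\<close>, \<open>insert i B\<close>, \<open>insert i C\<close> have no common element when \<open>A\<close>, \<open>B\<close>, \<open>C\<close> have none, so \<open>h\<close>
  and \<open>g\<close> satisfy the cross-intersection condition. In the resulting inequality between the mean \<open>a\<close> of
  \<open>h\<close> and the mean \<open>c\<close> of \<open>1 - g\<close> the product \<open>a * c\<close> is negligible against \<open>a\<close>, and the remaining term
  is geometric in \<open>a\<close> and \<open>c\<close>, so \<open>a\<close> is at most a fixed multiple of \<open>c\<close>. By
  \<open>(2 p - 1)\<^sup>2 \<le> p (1 - p) / 2\<close>, that is \<open>1/3 \<le> p \<le> 2/3\<close>, the multiple is small enough for the gain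
  \<open>(1 - p) * a\<close> outside the star to be clearly less than the loss \<open>p * c\<close> inside. As the loss exceeds
  the gain by \<open>p - mean p V f\<close>, both are bounded in terms of this difference.\<close>
lemma local_stability:
  assumes "1/2 \<le> p" "p \<le> 2/3" "finite V" "i \<in> V"
    and f: "\<And>A. A \<subseteq> V \<Longrightarrow> f A \<in> {0, 1}"
    and cross: "\<And>A B C. \<lbrakk>A \<subseteq> V; B \<subseteq> V; C \<subseteq> V; A \<inter> B \<inter> C = {}\<rbrakk> \<Longrightarrow> f A * f B * f C = 0"
    and b: "15/16 \<le> mean p V (\<lambda>A. f (insert i A))"
  shows "(1 - p) * mean p V (\<lambda>A. f (A - {i})) \<le> 2 * (p - mean p V f)"
proof -
  have p: "0 < p" "p < 1" using assms by auto
  define g where "g A = f (insert i A)" for A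
  define h where "h A = f (A - {i})" for A
  define a where "a = mean p V h"
  define c where "c = mean p V (\<lambda>A. 1 - g A)"
  define r where "r = - rho p"
  have r: "0 \<le> r" "r \<le> 1/2" using rho_bounds[OF assms(1,2)] by (auto simp: r_def)
  have g01: "g A \<in> {0, 1}" and h01: "h A \<in> {0, 1}" if "A \<subseteq> V" for A
    using f[of "insert i A"] f[of "A - {i}"] that assms(4) by (simp_all add: g_def h_def subset_insertI2 Diff_subset insert_subset Diff_subset_conv)
  have c': "c = 1 - mean p V g" by (simp add: c_def mean_diff mean_const assms(3))
  have c16: "c \<le> 1/16" using b by (simp add: c' g_def[abs_def])
  have sq_sum: "(\<Sum>S\<in>Pow V. (hat p V u S)\<^sup>2) = mean p V u" if "\<And>A. A \<subseteq> V \<Longrightarrow> u A \<in> {0, 1}" for u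
  proof -
    have "u A * u A = u A" if "A \<subseteq> V" for A using \<open>\<And>A. A \<subseteq> V \<Longrightarrow> u A \<in> {0, 1}\<close>[OF that] by auto
    then have "mean p V (\<lambda>A. u A * u A) = mean p V u" by (rule mean_cong)
    then show ?thesis using Parseval[OF p assms(3), of u u] by (simp add: power2_eq_square)
  qed
  have ha: "(\<Sum>S\<in>Pow V. (hat p V h S)\<^sup>2) = a" unfolding a_def by (rule sq_sum[OF h01])
  have gc: "(\<Sum>S\<in>Pow V. (hat p V (\<lambda>A. 1 - g A) S)\<^sup>2) = c"
    unfolding c_def
  proof (rule sq_sum)
    fix A assume "A \<subseteq> V"
    then have "g A \<in> {0, 1}" by (rule g01)
    then show "1 - g A \<in> {0, 1}" by auto
  qed
  have a0: "0 \<le> a" unfolding ha[symmetric] by (intro sum_nonneg) auto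
  have c0: "0 \<le> c" unfolding gc[symmetric] by (intro sum_nonneg) auto
  have "a \<le> 2 * noise p V h (\<lambda>A. 1 - g A)"
    unfolding a_def
  proof (rule mean_le_noise_of_cross_intersecting[OF p(1) assms(2,3) h01 g01])
    fix A B C assume "A \<subseteq> V" "B \<subseteq> V" "C \<subseteq> V" "A \<inter> B \<inter> C = {}"
    then show "h A * g B * g C = 0"
      unfolding h_def g_def using assms(4) by (intro cross) auto
  qed
  moreover have "noise p V h (\<lambda>A. 1 - g A) \<le> a * c + r * (sqrt a * sqrt c)"
  proof -
    let ?x = "\<lambda>S. hat p V h S" and ?y = "\<lambda>S. hat p V (\<lambda>A. 1 - g A) S"
    have "noise p V h (\<lambda>A. 1 - g A) = a * c + (\<Sum>S\<in>Pow V - {{}}. rho p ^ card S * (?x S * ?y S))"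
      unfolding noise_def a_def c_def using assms(3) by (subst sum.remove[of _ "{}"]) (auto simp: hat_empty)
    also have "(\<Sum>S\<in>Pow V - {{}}. rho p ^ card S * (?x S * ?y S)) \<le> (\<Sum>S\<in>Pow V - {{}}. r * (\<bar>?x S\<bar> * \<bar>?y S\<bar>))"
    proof (rule sum_mono)
      fix S assume S: "S \<in> Pow V - {{}}"
      then have "finite S" using assms(3) by (auto intro: finite_subset)
      with S have "card S \<noteq> 0" by simp
      then have "\<bar>rho p\<bar> ^ card S \<le> \<bar>rho p\<bar> ^ 1"
        using r by (intro power_decreasing) (auto simp: r_def)
      then have "\<bar>rho p ^ card S\<bar> \<le> r" using r by (simp add: power_abs r_def)
      then have "\<bar>rho p ^ card S\<bar> * (\<bar>?x S\<bar> * \<bar>?y S\<bar>) \<le> r * (\<bar>?x S\<bar> * \<bar>?y S\<bar>)"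
        by (intro mult_right_mono) auto
      then show "rho p ^ card S * (?x S * ?y S) \<le> r * (\<bar>?x S\<bar> * \<bar>?y S\<bar>)"
        unfolding abs_mult[symmetric] by linarith
    qed
    also have "\<dots> \<le> (\<Sum>S\<in>Pow V. r * (\<bar>?x S\<bar> * \<bar>?y S\<bar>))"
      using assms(3) r by (intro sum_mono2) auto
    also have "\<dots> = r * (\<Sum>S\<in>Pow V. \<bar>?x S\<bar> * \<bar>?y S\<bar>)" by (simp add: sum_distrib_left)
    also have "\<dots> \<le> r * (sqrt a * sqrt c)"
    proof (rule mult_left_mono[OF _ r(1)])
      have "(\<Sum>S\<in>Pow V. \<bar>?x S\<bar> * \<bar>?y S\<bar>)\<^sup>2 \<le> a * c"
        using Cauchy_Schwarz_ineq_sum[of "\<lambda>S. \<bar>?x S\<bar>" "\<lambda>S. \<bar>?y S\<bar>" "Pow V"] by (simp add: ha gc)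
      then show "(\<Sum>S\<in>Pow V. \<bar>?x S\<bar> * \<bar>?y S\<bar>) \<le> sqrt a * sqrt c"
        unfolding real_sqrt_mult[symmetric] by (rule real_le_rsqrt)
    qed
    finally show ?thesis by simp
  qed
  ultimately have le: "a * (1 - 2 * c) \<le> 2 * r * (sqrt a * sqrt c)"
    by (simp add: algebra_simps)
  have "a * (7/8) \<le> a * (1 - 2 * c)" using c16 a0 by (intro mult_left_mono) auto
  with le have "a * (7/8) \<le> 2 * r * (sqrt a * sqrt c)" by linarith
  then have sqr: "(a * (7/8))\<^sup>2 \<le> (2 * r * (sqrt a * sqrt c))\<^sup>2"
    using a0 by (intro power_mono) auto
  have "(2 * r * (sqrt a * sqrt c))\<^sup>2 = 4 * r\<^sup>2 * (a * c)"
    using a0 c0 by (simp add: power_mult_distrib)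
  from sqr[unfolded this] have "a * (a * (49/64)) \<le> a * (4 * r\<^sup>2 * c)"
    by (simp add: power2_eq_square mult_ac)
  then have ac: "a * (49/64) \<le> 4 * r\<^sup>2 * c"
    using a0 c0 r by (cases "a = 0") auto
  have rr: "(1 - p) * (4 * r\<^sup>2) \<le> p / 2"
  proof -
    have "2 * r * (1 - p) = 2 * p - 1"
      using p by (simp add: r_def rho_def field_simps)
    then have "(2 * r * (1 - p))\<^sup>2 = (2 * p - 1)\<^sup>2" by simp
    also have "\<dots> \<le> p / 2 * (1 - p)"
    proof -
      have "0 \<le> (3 * p - 1) * (2 - 3 * p)" using assms by (intro mult_nonneg_nonneg) auto
      then show ?thesis by (simp add: power2_eq_square algebra_simps)
    qed
    also have "(2 * r * (1 - p))\<^sup>2 = ((1 - p) * (4 * r\<^sup>2)) * (1 - p)"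
      by (simp add: power2_eq_square algebra_simps)
    finally show ?thesis using p by (simp only: mult_le_cancel_right)
  qed
  have split: "mean p V f = p * (1 - c) + (1 - p) * a"
    unfolding c' a_def h_def g_def using mean_split[OF assms(3,4), of p f] by simp
  have "(1 - p) * a * (49/64) \<le> (1 - p) * (4 * r\<^sup>2) * c"
    using mult_left_mono[OF ac, of "1 - p"] p by (simp add: mult_ac)
  also have "\<dots> \<le> p / 2 * c" using rr c0 by (intro mult_right_mono) auto
  also have "\<dots> = ((1 - p) * a + (p - mean p V f)) / 2"
    unfolding split by (simp add: algebra_simps)
  finally have X: "(1 - p) * a * (49/64) \<le> ((1 - p) * a + (p - mean p V f)) / 2" .
  have "x \<le> 2 * e" if "x * (49/64) \<le> (x + e) / 2" "0 \<le> x" for x e :: real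
    using that by (simp add: field_simps)
  from this[OF X] have "(1 - p) * a \<le> 2 * (p - mean p V f)" using p a0 by simp
  then show ?thesis by (simp add: a_def h_def[abs_def])
qed

section \<open>Changing the bias\<close>

text \<open>Concavity of \<open>x \<mapsto> x powr t\<close> on the nonnegative reals for \<open>0 < t \<le> 1\<close>.\<close>
lemma powr_increment_antimono:
  fixes x y h t :: real
  assumes "0 \<le> x" "x \<le> y" "0 \<le> h" "0 < t" "t \<le> 1"
  shows "(y + h) powr t - y powr t \<le> (x + h) powr t - x powr t"
proof (rule DERIV_nonpos_imp_decreasing_open[OF assms(2), of "\<lambda>z. (z + h) powr t - z powr t"])
  fix z assume z: "x < z" "z < y"
  have "((\<lambda>z. (z + h) powr t - z powr t) has_real_derivative
      t * (z + h) powr (t - 1) - t * z powr (t - 1)) (at z)"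
    using z assms by (auto intro!: derivative_eq_intros)
  moreover have "t * (z + h) powr (t - 1) \<le> t * z powr (t - 1)"
    using z assms by (intro mult_left_mono powr_mono2') auto
  ultimately show "\<exists>d. ((\<lambda>z. (z + h) powr t - z powr t) has_real_derivative d) (at z) \<and> d \<le> 0"
    by (intro exI[of _ "t * (z + h) powr (t - 1) - t * z powr (t - 1)"]) simp
next
  show "continuous_on {x..y} (\<lambda>z. (z + h) powr t - z powr t)"
    using assms by (intro continuous_intros continuous_on_powr') auto
qed

lemma mean_mono_p:
  assumes "0 \<le> p" "p \<le> q" "q \<le> 1" "finite V"
    and "\<And>A B. A \<subseteq> B \<Longrightarrow> B \<subseteq> V \<Longrightarrow> f A \<le> f B"
  shows "mean p V f \<le> mean q V f"
  using assms(4,5)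
proof (induction V arbitrary: f rule: finite_induct)
  case empty
  then show ?case by (simp add: mean_empty)
next
  case (insert x V)
  let ?g = "\<lambda>A. f (insert x A)"
  have "mean p V ?g \<le> mean q V ?g"
    by (rule insert.IH) (intro insert.prems; auto)
  then have 1: "p * mean p V ?g \<le> p * mean q V ?g" using assms by (intro mult_left_mono) auto
  have "mean p V f \<le> mean q V f"
    by (rule insert.IH) (intro insert.prems; auto)
  then have 2: "(1 - p) * mean p V f \<le> (1 - p) * mean q V f" using assms by (intro mult_left_mono) auto
  have "mean q V f \<le> mean q V ?g"
    using assms by (intro mean_mono insert.prems) auto
  then have "(q - p) * mean q V f \<le> (q - p) * mean q V ?g" using assms by (intro mult_left_mono) auto
  with 1 2 show ?case
    unfolding mean_insert[OF insert(1,2)] by (simp add: algebra_simps)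
qed

text \<open>Adding an element to \<open>V\<close> reduces the claim to
  \<open>(p b + (1 - p) a) powr t \<le> p powr t * b powr t + (1 - p powr t) * a powr t\<close> for \<open>0 \<le> a \<le> b\<close>.
  That is the comparison of the increments of \<open>x powr t\<close> over a step of length \<open>p (b - a)\<close> starting at
  \<open>a\<close> and at \<open>p a\<close>.\<close>
lemma mean_powr:
  assumes p: "0 < p" "p < 1" and t: "0 < t" "t \<le> 1" and "finite V"
    and "\<And>A. A \<subseteq> V \<Longrightarrow> f A \<in> {0, 1}"
    and "\<And>A B. A \<subseteq> B \<Longrightarrow> B \<subseteq> V \<Longrightarrow> f A \<le> f B"
  shows "(mean p V f) powr t \<le> mean (p powr t) V f"
  using assms(5-)
proof (induction V arbitrary: f rule: finite_induct)
  case empty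
  then have "f {} = 0 \<or> f {} = 1" by blast
  then show ?case by (auto simp: mean_empty)
next
  case (insert x V)
  let ?g = "\<lambda>A. f (insert x A)"
  define a where "a = mean p V f"
  define b where "b = mean p V ?g"
  have sub: "A \<subseteq> insert x V" "insert x A \<subseteq> insert x V" if "A \<subseteq> V" for A using that by auto
  have f0: "0 \<le> f A" if "A \<subseteq> V" for A using insert.prems(1)[OF sub(1)[OF that]] by auto
  have "mean p V (\<lambda>_. 0) \<le> a"
    unfolding a_def using p f0 by (intro mean_mono) auto
  then have a0: "0 \<le> a" by (simp add: mean_const insert)
  have ab: "a \<le> b"
    unfolding a_def b_def using p by (intro mean_mono insert.prems(2)) auto
  have IHg: "b powr t \<le> mean (p powr t) V ?g"
    unfolding b_def
  proof (rule insert.IH)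
    show "f (insert x A) \<in> {0, 1}" if "A \<subseteq> V" for A using insert.prems(1)[OF sub(2)[OF that]] .
  qed (intro insert.prems; auto)
  have IHf: "a powr t \<le> mean (p powr t) V f"
    unfolding a_def
  proof (rule insert.IH)
    show "f A \<in> {0, 1}" if "A \<subseteq> V" for A using insert.prems(1)[OF sub(1)[OF that]] .
  qed (intro insert.prems; auto)
  have pt: "0 \<le> p powr t" "p powr t \<le> 1"
    using p t powr_mono2[of t p 1] by auto
  have pa: "p * a \<le> a" using p a0 by (simp add: mult_left_le_one_le)
  \<comment> \<open>The step of length \<open>p * (b - a)\<close> leads from \<open>a\<close> to the new mean and from \<open>p * a\<close> to \<open>p * b\<close>.\<close>
  have "(a + p * (b - a)) powr t - a powr t \<le> (p * a + p * (b - a)) powr t - (p * a) powr t"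
    using p a0 ab t pa by (intro powr_increment_antimono) auto
  also have "p * a + p * (b - a) = p * b" by (simp add: algebra_simps)
  also have "a + p * (b - a) = p * b + (1 - p) * a" by (simp add: algebra_simps)
  finally have "(p * b + (1 - p) * a) powr t \<le> p powr t * b powr t + (1 - p powr t) * a powr t"
    using p a0 ab by (simp add: powr_mult left_diff_distrib)
  also have "\<dots> \<le> p powr t * mean (p powr t) V ?g + (1 - p powr t) * mean (p powr t) V f"
    using pt IHg IHf by (intro add_mono mult_left_mono) auto
  finally show ?case
    unfolding mean_insert[OF insert(1,2)] a_def b_def .
qed

lemma mean_half_complement:
  assumes "finite V"
  shows "mean (1/2) V (\<lambda>A. f (V - A)) = mean (1/2) V f"
proof -
  have w: "(1/2) ^ card A * (1 - 1/2) ^ card (V - A) = (1/2 :: real) ^ card V" if "A \<subseteq> V" for A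
  proof -
    have "card A + card (V - A) = card V"
      using that assms by (metis card_Diff_subset card_mono finite_subset le_add_diff_inverse)
    then show ?thesis by (simp flip: power_add)
  qed
  have "mean (1/2) V g = (\<Sum>A\<in>Pow V. (1/2) ^ card V * g A)" for g
    unfolding mean_def using w by (intro sum.cong) auto
  moreover have "(\<Sum>A\<in>Pow V. (1/2 :: real) ^ card V * f (V - A)) = (\<Sum>A\<in>Pow V. (1/2) ^ card V * f A)"
    by (rule sum.reindex_bij_witness[of _ "\<lambda>A. V - A" "\<lambda>A. V - A"]) auto
  ultimately show ?thesis by simp
qed

text \<open>At bias \<open>1/2\<close> a set and its complement are equally likely, and monotonicity in the bias covers
  smaller \<open>p\<close>.\<close>
lemma mean_le_half:
  assumes "0 \<le> p" "p \<le> 1/2" "finite V"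
    and mono: "\<And>A B. A \<subseteq> B \<Longrightarrow> B \<subseteq> V \<Longrightarrow> g A \<le> g B"
    and compl: "\<And>A. A \<subseteq> V \<Longrightarrow> g A + g (V - A) \<le> 1"
  shows "mean p V g \<le> 1/2"
proof -
  have "mean p V g \<le> mean (1/2) V g"
    by (rule mean_mono_p) (use assms in auto)
  moreover have "mean (1/2) V (\<lambda>A. g A + g (V - A)) \<le> mean (1/2) V (\<lambda>_. 1)"
    using compl by (intro mean_mono) auto
  then have "mean (1/2) V g + mean (1/2) V g \<le> 1"
    by (simp add: mean_add mean_half_complement mean_const assms(3))
  ultimately show ?thesis by simp
qed

section \<open>Families of subsets of \<open>{1..n}\<close>\<close>

text \<open>The indicator function of the up-closure of \<open>\<A>\<close>.\<close>
definition up_ind :: "'a set set \<Rightarrow> 'a set \<Rightarrow> real" where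
  "up_ind \<A> B = of_bool (\<exists>A\<in>\<A>. A \<subseteq> B)"

lemma wise_intersecting_3D:
  assumes "wise_intersecting 3 \<A>" "A \<in> \<A>" "B \<in> \<A>" "C \<in> \<A>"
  shows "A \<inter> B \<inter> C \<noteq> {}"
proof -
  define F where "F i = (if i = 1 then A else if i = 2 then B else C)" for i :: nat
  have "\<forall>i\<in>{1..3}. F i \<in> \<A>" using assms(2-4) by (simp add: F_def)
  then have "(\<Inter>i\<in>{1..3}. F i) \<noteq> {}" using assms(1) unfolding wise_intersecting_def by blast
  moreover have "{1..3} = {1, 2, 3 :: nat}" by auto
  ultimately show ?thesis by (auto simp: F_def)
qed

lemma up_ind_range: "up_ind \<A> B \<in> {0, 1}"
  by (simp add: up_ind_def of_bool_def)

lemma up_ind_mono: "A \<subseteq> B \<Longrightarrow> up_ind \<A> A \<le> up_ind \<A> B"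
  by (auto simp: up_ind_def)

lemma up_ind_cross:
  assumes "wise_intersecting 3 \<A>" "A \<inter> B \<inter> C = {}"
  shows "up_ind \<A> A * up_ind \<A> B * up_ind \<A> C = 0"
proof (rule ccontr)
  assume "up_ind \<A> A * up_ind \<A> B * up_ind \<A> C \<noteq> 0"
  then obtain A' B' C' where "A' \<in> \<A>" "B' \<in> \<A>" "C' \<in> \<A>" "A' \<subseteq> A" "B' \<subseteq> B" "C' \<subseteq> C"
    by (auto simp: up_ind_def)
  with wise_intersecting_3D[OF assms(1)] assms(2) show False by blast
qed

lemma up_intersecting_up_ind: "wise_intersecting 3 \<A> \<Longrightarrow> up_intersecting V (up_ind \<A>)"
  unfolding up_intersecting_def by (intro conjI allI impI up_ind_range up_ind_mono up_ind_cross)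

lemma mu_eq_mean_indicator:
  assumes "\<A> \<subseteq> Pow {1..n}"
  shows "mu n (\<lambda>_. p) \<A> = mean p {1..n} (\<lambda>A. of_bool (A \<in> \<A>))"
proof -
  have "mean p {1..n} (\<lambda>A. of_bool (A \<in> \<A>)) = (\<Sum>A\<in>\<A>. p ^ card A * (1 - p) ^ card ({1..n} - A))"
    unfolding mean_def using assms by (intro sum.mono_neutral_cong_right) auto
  then show ?thesis by (simp add: mu_def mu_set_def)
qed

text \<open>The star has measure \<open>p\<close>, so the sets of the star not in \<open>\<A>\<close> outweigh the members of \<open>\<A>\<close> outside
  the star by exactly \<open>p - mu n (\<lambda>_. p) \<A>\<close>. Only the members outside the star remain to be estimated.\<close>
lemma mu_sym_diff_star:
  assumes "\<A> \<subseteq> Pow {1..n}" "i \<in> {1..n}"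
  shows "mu n (\<lambda>_. p) (sym_diff \<A> {A \<in> Pow {1..n}. i \<in> A}) =
    p - mu n (\<lambda>_. p) \<A> + 2 * (1 - p) * mean p {1..n} (\<lambda>A. of_bool (A - {i} \<in> \<A>))"
proof -
  let ?V = "{1..n}" and ?B = "{A \<in> Pow {1..n}. i \<in> A}"
  have "mean p ?V (\<lambda>A. of_bool (i \<in> A)) = p"
    using mean_split[of ?V i p "\<lambda>A. of_bool (i \<in> A)"] assms(2) by (simp add: mean_const)
  moreover have "mean p ?V (\<lambda>A. of_bool (A \<in> \<A> \<and> i \<notin> A)) =
      (1 - p) * mean p ?V (\<lambda>A. of_bool (A - {i} \<in> \<A>))"
    using mean_split[of ?V i p "\<lambda>A. of_bool (A \<in> \<A> \<and> i \<notin> A)"] assms(2) by (simp add: mean_const)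
  moreover have "mu n (\<lambda>_. p) (sym_diff \<A> ?B) =
      mean p ?V (\<lambda>A. (of_bool (i \<in> A) - of_bool (A \<in> \<A>)) + 2 * of_bool (A \<in> \<A> \<and> i \<notin> A))"
    using assms(1) by (subst mu_eq_mean_indicator) (auto intro!: mean_cong)
  ultimately show ?thesis
    unfolding mean_add mean_diff mean_cmult mu_eq_mean_indicator[OF assms(1)] by simp
qed

lemma stability_constant_ge_9:
  fixes p :: real
  assumes "1/2 < p" "p < 2/3"
  shows "9 \<le> 16 * p * (1 - p)^2 / ((2 * p - 1) * (3 - 4 * p))"
proof -
  have pos: "0 < (2 * p - 1) * (3 - 4 * p)" using assms by (intro mult_pos_pos) auto
  have "0 \<le> (p - 5/8)\<^sup>2" by simp
  then have up: "9 * ((2 * p - 1) * (3 - 4 * p)) \<le> 9/8" by (simp add: power2_eq_square algebra_simps)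
  have "2/9 \<le> p * (1 - p)"
  proof -
    have "0 \<le> (p - 1/3) * (2/3 - p)" using assms by (intro mult_nonneg_nonneg) auto
    then show ?thesis by (simp add: field_simps)
  qed
  then have "2/9 * (1/3) \<le> p * (1 - p) * (1 - p)" using assms by (intro mult_mono) auto
  moreover have "16 * p * (1 - p)\<^sup>2 = 16 * (p * (1 - p) * (1 - p))"
    by (simp add: power2_eq_square mult_ac)
  ultimately have "32/27 \<le> 16 * p * (1 - p)\<^sup>2" by linarith
  with up have "9 * ((2 * p - 1) * (3 - 4 * p)) \<le> 16 * p * (1 - p)\<^sup>2" by simp
  then show ?thesis using pos by (simp add: pos_le_divide_eq)
qed

text \<open>Influence at least \<open>15/16\<close> makes the family close enough to a star for the local bound. The
  members of \<open>\<A>\<close> outside the star are among those of the up-closure, hence of measure at most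
  \<open>2 * \<epsilon>\<close>, and they count twice in the symmetric difference.\<close>
lemma star_stability_above_half:
  assumes "1/2 < p" "p < 2/3"
  shows "\<exists>\<delta>>0. \<forall>\<epsilon> n \<A>. \<epsilon> < \<delta> \<longrightarrow> \<A> \<subseteq> Pow {1..n} \<longrightarrow> wise_intersecting 3 \<A> \<longrightarrow> mu n (\<lambda>_. p) \<A> = p - \<epsilon> \<longrightarrow>
       (\<exists>\<B>. star n \<B> \<and> mu n (\<lambda>_. p) (sym_diff \<A> \<B>) \<le> 5 * \<epsilon>)"
proof -
  have p: "0 < p" "p < 1" "1/2 \<le> p" "p \<le> 2/3" using assms by auto
  obtain \<delta> where \<delta>: "0 < \<delta>"
    and stab: "\<And>(V :: nat set) f. \<lbrakk>finite V; up_intersecting V f; p - \<delta> \<le> mean p V f\<rbrakk> \<Longrightarrow>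
       \<exists>i\<in>V. 1 - 1/16 \<le> mean p V (dderiv i f)"
    using dictator_stability[of p "1/16", where 'a = nat] assms by auto
  have "\<exists>\<B>. star n \<B> \<and> mu n (\<lambda>_. p) (sym_diff \<A> \<B>) \<le> 5 * \<epsilon>"
    if "\<epsilon> < \<delta>" and sub: "\<A> \<subseteq> Pow {1..n}" and int: "wise_intersecting 3 \<A>"
      and mu: "mu n (\<lambda>_. p) \<A> = p - \<epsilon>" for \<epsilon> n \<A>
  proof -
    let ?V = "{1..n}"
    define f where "f = up_ind \<A>"
    have f01: "f A \<in> {0, 1}" for A unfolding f_def by (rule up_ind_range)
    have f_cross: "f A * f B * f C = 0" if "A \<inter> B \<inter> C = {}" for A B C
      using up_ind_cross[OF int that] by (simp add: f_def)
    have mem: "of_bool (A \<in> \<A>) \<le> f A" for A by (auto simp: f_def up_ind_def)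
    have m: "p - \<epsilon> \<le> mean p ?V f"
      using p mem unfolding mu[symmetric] mu_eq_mean_indicator[OF sub] by (intro mean_mono) auto
    have "\<exists>i\<in>?V. 1 - 1/16 \<le> mean p ?V (dderiv i f)"
      using m \<open>\<epsilon> < \<delta>\<close> by (intro stab) (auto simp: f_def up_intersecting_up_ind[OF int])
    then obtain i where i: "i \<in> ?V" and I: "15/16 \<le> mean p ?V (dderiv i f)" by auto
    have "mean p ?V (dderiv i f) \<le> mean p ?V (\<lambda>A. f (insert i A))"
    proof (rule mean_mono)
      fix A
      have "0 \<le> f (A - {i})" using f01[of "A - {i}"] by auto
      then show "dderiv i f A \<le> f (insert i A)" by (simp add: dderiv_def)
    qed (use p in auto)
    then have "15/16 \<le> mean p ?V (\<lambda>A. f (insert i A))" using I by linarith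
    then have "(1 - p) * mean p ?V (\<lambda>A. f (A - {i})) \<le> 2 * (p - mean p ?V f)"
      by (intro local_stability p i f01 f_cross) auto
    moreover have "(1 - p) * mean p ?V (\<lambda>A. of_bool (A - {i} \<in> \<A>)) \<le> (1 - p) * mean p ?V (\<lambda>A. f (A - {i}))"
      using p mem by (intro mult_left_mono mean_mono) auto
    moreover have "2 * (p - mean p ?V f) \<le> 2 * \<epsilon>" using m by simp
    ultimately have "(1 - p) * mean p ?V (\<lambda>A. of_bool (A - {i} \<in> \<A>)) \<le> 2 * \<epsilon>"
      by linarith
    then have "mu n (\<lambda>_. p) (sym_diff \<A> {A \<in> Pow ?V. i \<in> A}) \<le> 5 * \<epsilon>"
      unfolding mu_sym_diff_star[OF sub i] mu by linarith
    moreover have "star n {A \<in> Pow ?V. i \<in> A}" using i by (auto simp: star_def)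
    ultimately show ?thesis by blast
  qed
  then show ?thesis using \<delta> by (intro exI[of _ \<delta>]) simp
qed

text \<open>The bias \<open>3/5\<close> stands for any value strictly between \<open>1/2\<close> and \<open>2/3\<close>; the element \<open>i\<close> found there
  is used at the original bias. Lowering the bias does not increase the mean of an up-closed
  family, so the part avoiding \<open>i\<close> still has mean at most \<open>p / 4\<close> at bias \<open>p\<close>, and the part containing
  \<open>i\<close> has to supply the rest of \<open>p - \<epsilon>\<close>.\<close>
lemma star_containment_upto_half:
  assumes "0 < p" "p \<le> 1/2"
  shows "\<exists>\<delta>>0. \<forall>\<epsilon> n \<A>. 0 < \<epsilon> \<longrightarrow> \<epsilon> < \<delta> \<longrightarrow> \<A> \<subseteq> Pow {1..n} \<longrightarrow> wise_intersecting 3 \<A> \<longrightarrow> mu n (\<lambda>_. p) \<A> = p - \<epsilon> \<longrightarrow>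
       (\<exists>\<B>. star n \<B> \<and> \<A> \<subseteq> \<B>)"
proof -
  define T where "T = ln (3/5) / ln p"
  have lnp: "ln p < 0" "ln p \<le> ln (3/5)" "ln (3/5 :: real) < 0" using assms by auto
  have T: "0 < T" "T \<le> 1" "p powr T = 3/5"
    using lnp assms by (auto simp: T_def powr_def divide_simps)
  obtain \<gamma> where \<gamma>: "0 < \<gamma>"
    and stab: "\<And>(V :: nat set) f. \<lbrakk>finite V; up_intersecting V f; 3/5 - \<gamma> \<le> mean (3/5) V f\<rbrakk> \<Longrightarrow>
       \<exists>i\<in>V. 1 - p/4 \<le> mean (3/5) V (dderiv i f)"
    using dictator_stability[of "3/5" "p/4", where 'a = nat] assms by auto
  have "((\<lambda>e. (p - e) powr T) \<longlongrightarrow> (p - 0) powr T) (at_right 0)"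
    using assms by (intro tendsto_intros) auto
  then have "\<forall>\<^sub>F e in at_right 0. 3/5 - \<gamma> < (p - e) powr T"
    by (rule order_tendstoD) (use T \<gamma> in simp)
  then obtain \<beta> where \<beta>: "0 < \<beta>" "\<And>e. 0 < e \<Longrightarrow> e < \<beta> \<Longrightarrow> 3/5 - \<gamma> < (p - e) powr T"
    unfolding eventually_at_right_field by auto
  define \<delta> where "\<delta> = min \<beta> (p / 8)"
  have "\<exists>\<B>. star n \<B> \<and> \<A> \<subseteq> \<B>"
    if \<epsilon>: "0 < \<epsilon>" "\<epsilon> < \<delta>" and sub: "\<A> \<subseteq> Pow {1..n}" and int: "wise_intersecting 3 \<A>"
      and mu: "mu n (\<lambda>_. p) \<A> = p - \<epsilon>" for \<epsilon> n \<A>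
  proof -
    let ?V = "{1..n}"
    define f where "f = up_ind \<A>"
    have f01: "f A \<in> {0, 1}" for A unfolding f_def by (rule up_ind_range)
    have f_ge0: "0 \<le> f A" and f_le1: "f A \<le> 1" for A using f01[of A] by auto
    have f_mono: "f A \<le> f B" if "A \<subseteq> B" for A B using up_ind_mono[OF that] by (simp add: f_def)
    have f_cross: "f A * f B * f C = 0" if "A \<inter> B \<inter> C = {}" for A B C
      using up_ind_cross[OF int that] by (simp add: f_def)
    have m: "p - \<epsilon> \<le> mean p ?V f"
      using assms unfolding mu[symmetric] mu_eq_mean_indicator[OF sub]
      by (intro mean_mono) (auto simp: f_def up_ind_def)
    have \<epsilon>p: "\<epsilon> < p / 8" "\<epsilon> < \<beta>" using \<epsilon> by (auto simp: \<delta>_def)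
    have "3/5 - \<gamma> \<le> (p - \<epsilon>) powr T" using \<beta>(2)[OF \<epsilon>(1) \<epsilon>p(2)] by simp
    also have "\<dots> \<le> (mean p ?V f) powr T"
      using m \<epsilon>p assms T by (intro powr_mono2) auto
    also have "\<dots> \<le> mean (p powr T) ?V f"
      using assms T by (intro mean_powr f01 f_mono) auto
    finally have m': "3/5 - \<gamma> \<le> mean (3/5) ?V f" using T by simp
    have "\<exists>i\<in>?V. 1 - p/4 \<le> mean (3/5) ?V (dderiv i f)"
      using m' by (intro stab) (auto simp: f_def up_intersecting_up_ind[OF int])
    then obtain i where i: "i \<in> ?V" and I: "1 - p/4 \<le> mean (3/5) ?V (dderiv i f)" by auto
    define a where "a = mean p ?V (\<lambda>A. f (A - {i}))"
    define b where "b = mean p ?V (\<lambda>A. f (insert i A))"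
    have "a \<le> mean (3/5) ?V (\<lambda>A. f (A - {i}))"
      unfolding a_def using assms by (intro mean_mono_p f_mono) auto
    moreover have "mean (3/5) ?V (\<lambda>A. f (insert i A)) \<le> mean (3/5) ?V (\<lambda>_. 1)"
      using f_le1 by (intro mean_mono) auto
    then have "mean (3/5) ?V (\<lambda>A. f (insert i A)) \<le> 1" by (simp add: mean_const)
    moreover have "mean (3/5) ?V (dderiv i f) =
        mean (3/5) ?V (\<lambda>A. f (insert i A)) - mean (3/5) ?V (\<lambda>A. f (A - {i}))"
      unfolding mean_diff[symmetric] by (simp add: dderiv_def[abs_def])
    ultimately have a: "a \<le> p / 4" using I by linarith
    have "mean p ?V (\<lambda>_. 0) \<le> a" unfolding a_def using f_ge0 assms by (intro mean_mono) auto
    then have a0: "0 \<le> a" by (simp add: mean_const)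
    have "mean p ?V f = p * b + (1 - p) * a"
      unfolding a_def b_def using i by (intro mean_split) auto
    moreover have "(1 - p) * a \<le> 1 * a" using assms a0 by (intro mult_right_mono) auto
    ultimately have "p * (1/2) < p * b" using m a \<epsilon>p assms by linarith
    then have b: "1/2 < b" using assms by simp
    have "A \<in> {A \<in> Pow ?V. i \<in> A}" if A: "A \<in> \<A>" for A
    proof (rule ccontr)
      assume "A \<notin> {A \<in> Pow ?V. i \<in> A}"
      then have iA: "i \<notin> A" "A \<subseteq> ?V" using A sub by auto
      have fA: "f A = 1" using A by (auto simp: f_def up_ind_def)
      have "b \<le> 1/2"
        unfolding b_def
      proof (rule mean_le_half)
        fix B assume "B \<subseteq> ?V"
        \<comment> \<open>\<open>B\<close> and its complement, both completed by \<open>i\<close>, meet only in \<open>i\<close>, which \<open>A\<close> avoids.\<close>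
        have "insert i B \<inter> insert i (?V - B) \<inter> A = {}" using iA by auto
        then have "f (insert i B) * f (insert i (?V - B)) * f A = 0" by (rule f_cross)
        then show "f (insert i B) + f (insert i (?V - B)) \<le> 1"
          using fA f_le1[of "insert i B"] f_le1[of "insert i (?V - B)"] by auto
      qed (use assms in \<open>auto intro: f_mono\<close>)
      with b show False by simp
    qed
    then have "\<A> \<subseteq> {A \<in> Pow ?V. i \<in> A}" by blast
    moreover have "star n {A \<in> Pow ?V. i \<in> A}" using i by (auto simp: star_def)
    ultimately show ?thesis by blast
  qed
  moreover have "0 < \<delta>" using \<beta>(1) assms by (simp add: \<delta>_def)
  ultimately show ?thesis by (intro exI[of _ \<delta>]) simp
qed

theorem theorem3:
  fixes p :: real
  assumes "0 < p" and "p < 2/3"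
  shows "\<exists>(\<epsilon>\<^sub>p :: real) (\<eta>\<^sub>p :: real \<Rightarrow> real).
           0 < \<epsilon>\<^sub>p \<and> (\<eta>\<^sub>p \<longlongrightarrow> 0) (at_right 0) \<and>
           (\<forall>(\<epsilon> :: real) (n :: nat) (\<A> :: nat set set).
              0 < \<epsilon> \<longrightarrow> \<epsilon> < \<epsilon>\<^sub>p \<longrightarrow> 0 < n \<longrightarrow>
              \<A> \<subseteq> Pow {1..n} \<longrightarrow> wise_intersecting 3 \<A> \<longrightarrow>
              mu n (\<lambda>_. p) \<A> = p - \<epsilon> \<longrightarrow>
              (\<exists>\<B>. star n \<B> \<and>
                 (p \<le> 1/2 \<longrightarrow> \<A> \<subseteq> \<B>) \<and>
                 (p > 1/2 \<longrightarrow>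
                    mu n (\<lambda>_. p) (sym_diff \<A> \<B>)
                      < (16 * p * (1 - p)^2 / ((2 * p - 1) * (3 - 4 * p)) + \<eta>\<^sub>p \<epsilon>) * \<epsilon>)))"
proof (cases "p \<le> 1/2")
  case True
  obtain \<delta> where "0 < \<delta>"
    "\<And>\<epsilon> n \<A>. \<lbrakk>0 < \<epsilon>; \<epsilon> < \<delta>; \<A> \<subseteq> Pow {1..n}; wise_intersecting 3 \<A>; mu n (\<lambda>_. p) \<A> = p - \<epsilon>\<rbrakk> \<Longrightarrow>
       \<exists>\<B>. star n \<B> \<and> \<A> \<subseteq> \<B>"
    using star_containment_upto_half[OF assms(1) True] by blast
  with True show ?thesis
    by (intro exI[of _ \<delta>] exI[of _ "\<lambda>_. 0"]) auto
next
  case False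
  then have "1/2 < p" by simp
  obtain \<delta> where \<delta>: "0 < \<delta>"
    "\<And>\<epsilon> n \<A>. \<lbrakk>\<epsilon> < \<delta>; \<A> \<subseteq> Pow {1..n}; wise_intersecting 3 \<A>; mu n (\<lambda>_. p) \<A> = p - \<epsilon>\<rbrakk> \<Longrightarrow>
       \<exists>\<B>. star n \<B> \<and> mu n (\<lambda>_. p) (sym_diff \<A> \<B>) \<le> 5 * \<epsilon>"
    using star_stability_above_half[OF \<open>1/2 < p\<close> assms(2)] by blast
  define C where "C = 16 * p * (1 - p)^2 / ((2 * p - 1) * (3 - 4 * p))"
  have C: "9 \<le> C" unfolding C_def by (rule stability_constant_ge_9[OF \<open>1/2 < p\<close> assms(2)])
  have "\<exists>\<B>. star n \<B> \<and> mu n (\<lambda>_. p) (sym_diff \<A> \<B>) < C * \<epsilon>"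
    if "0 < \<epsilon>" "\<epsilon> < \<delta>" "\<A> \<subseteq> Pow {1..n}" "wise_intersecting 3 \<A>" "mu n (\<lambda>_. p) \<A> = p - \<epsilon>" for \<epsilon> n \<A>
  proof -
    have "5 * \<epsilon> < C * \<epsilon>" using that(1) C by (intro mult_strict_right_mono) auto
    then show ?thesis using \<delta>(2)[OF that(2-)] by fastforce
  qed
  with \<delta>(1) False show ?thesis
    unfolding C_def[symmetric] by (intro exI[of _ \<delta>] exI[of _ "\<lambda>_. 0"]) auto
qed

end
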